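(* The functor $\mathcal{A}_{-1}$ classifies rational tangles up to isotopy: two rational tangles $T,T'$ are isotopic if and only if the spans $\mathcal{A}_{-1}(T)$ and $\mathcal{A}_{-1}(T')$ are equivalent.
   Context: Rational tangles are unoriented 2-tangles (two bottom and two top endpoints), considered up to isotopy fixing the endpoints, obtained from the trivial tangle $[\infty]$ (two vertical strands) or its rotation $[0]$ by finitely many horizontal and vertical twists of endpoints; by Conway's theorem they are classified up to isotopy by their fraction $p/q\in\mathbb{Q}\cup\{\infty\}$. For an unoriented 2-tangle $T$ with diagram $D$, $\mathcal{A}_{-1}(T)$ is the span $\mathbb{C}^2\xleftarrow{f}Z\xrightarrow{g}\mathbb{C}^2$, where $Z$ is the space of assignments of complex numbers to the arcs of $D$ with $2a=b+c$ at every crossing ($a$ the overarc, $b,c$ the two underarcs), and $f$ (resp. $g$) records the values at the bottom (resp. top) endpoints from left to right. Two spans $(Z,f,g)$, $(Z',f',g')$ are equivalent if there is a linear isomorphism $\varphi:Z\to Z'$ with $f=f'\varphi$, $g=g'\varphi$; the equivalence class of $\mathcal{A}_{-1}(T)$ depends only on the isotopy class of $T$. *)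

theory Defs
  imports Complex_Main
begin

text \<open>Diagrams are in Morse position: a diagram is the list of its elementary layers from bottom to
  top, and a layer \<open>(i, p)\<close> consists of the piece \<open>p\<close> with exactly \<open>i\<close> vertical strands to its left.
  Tangles are unoriented, so a crossing is given by the direction of its overstrand, read upwards:
  from bottom left to top right for \<open>OverRight\<close>, from bottom right to top left for \<open>OverLeft\<close>.
  \<open>Cup\<close> is a local minimum and \<open>Cap\<close> a local maximum.\<close>

datatype piece = Cup | Cap | OverRight | OverLeft

type_synonym layers = "(nat \<times> piece) list"

fun ins :: "piece \<Rightarrow> nat" where
  "ins Cup = 0"
| "ins Cap = 2"
| "ins OverRight = 2"
| "ins OverLeft = 2"

fun outs :: "piece \<Rightarrow> nat" where
  "outs Cup = 2"
| "outs Cap = 0"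
| "outs OverRight = 2"
| "outs OverLeft = 2"

definition crossing :: "piece \<Rightarrow> bool" where
  "crossing p \<longleftrightarrow> p \<in> {OverRight, OverLeft}"

fun diagram :: "nat \<Rightarrow> layers \<Rightarrow> nat \<Rightarrow> bool" where
  "diagram m [] n \<longleftrightarrow> m = n"
| "diagram m ((i, p) # D) n \<longleftrightarrow> i + ins p \<le> m \<and> diagram (m - ins p + outs p) D n"

abbreviation two_tangle :: "layers \<Rightarrow> bool" where
  "two_tangle D \<equiv> diagram 2 D 2"

text \<open>Isotopy of tangles relative to the endpoints, in its diagrammatic form: planar isotopy of
  diagrams in Morse position and the Reidemeister moves. The rules \<open>far\<close> (exchange of the heights of
  two pieces lying side by side, \<open>p\<close> to the left of \<open>q\<close>), \<open>zigzag\<close> and \<open>swing\<close> (a strand passing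
  over or under a maximum or a minimum) generate planar isotopy together with the rotated versions of
  the Reidemeister moves. All rules are used in both directions.\<close>

inductive move :: "layers \<Rightarrow> layers \<Rightarrow> bool" where
  far: "move [(i, p), (i + outs p + k, q)] [(i + ins p + k, q), (i, p)]"
| zigzag_left: "move [(i, Cup), (i + 1, Cap)] []"
| zigzag_right: "move [(i + 1, Cup), (i, Cap)] []"
| swing_cap_under: "move [(i, OverRight), (i + 1, Cap)] [(i + 1, OverLeft), (i, Cap)]"
| swing_cap_over: "move [(i, OverLeft), (i + 1, Cap)] [(i + 1, OverRight), (i, Cap)]"
| swing_cup_over: "move [(i + 1, Cup), (i, OverRight)] [(i, Cup), (i + 1, OverLeft)]"
| swing_cup_under: "move [(i + 1, Cup), (i, OverLeft)] [(i, Cup), (i + 1, OverRight)]"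
| reidemeister1_cap: "crossing x \<Longrightarrow> move [(i, x), (i, Cap)] [(i, Cap)]"
| reidemeister1_cup: "crossing x \<Longrightarrow> move [(i, Cup), (i, x)] [(i, Cup)]"
| reidemeister2_right: "move [(i, OverRight), (i, OverLeft)] []"
| reidemeister2_left: "move [(i, OverLeft), (i, OverRight)] []"
| reidemeister3: "crossing x \<Longrightarrow>
    move [(i, x), (i + 1, x), (i, x)] [(i + 1, x), (i, x), (i + 1, x)]"

definition step :: "layers \<Rightarrow> layers \<Rightarrow> bool" where
  "step D D' \<longleftrightarrow> two_tangle D \<and> two_tangle D' \<and>
     (\<exists>A L R B. move L R \<and> D = A @ L @ B \<and> D' = A @ R @ B)"

definition isotopic :: "layers \<Rightarrow> layers \<Rightarrow> bool" where
  "isotopic = equivclp step"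

text \<open>\<open>hsum D E\<close> puts \<open>D\<close> to the left of \<open>E\<close> and joins the right endpoints of \<open>D\<close> to the left
  endpoints of \<open>E\<close>; the vertical composite of \<open>D\<close> with \<open>E\<close> above it is \<open>D @ E\<close>.\<close>

definition hsum :: "layers \<Rightarrow> layers \<Rightarrow> layers" where
  "hsum D E = [(1, Cup)] @ D @ map (\<lambda>(i, p). (i + 2, p)) E @ [(1, Cap)]"

definition tangle_infinity :: layers where
  "tangle_infinity = []"

definition tangle_zero :: layers where
  "tangle_zero = [(0, Cap), (0, Cup)]"

inductive rational :: "layers \<Rightarrow> bool" where
  infinity: "rational tangle_infinity"
| zero: "rational tangle_zero"
| twist_top: "rational D \<Longrightarrow> crossing x \<Longrightarrow> rational (D @ [(0, x)])"
| twist_bottom: "rational D \<Longrightarrow> crossing x \<Longrightarrow> rational ([(0, x)] @ D)"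
| twist_right: "rational D \<Longrightarrow> crossing x \<Longrightarrow> rational (hsum D [(0, x)])"
| twist_left: "rational D \<Longrightarrow> crossing x \<Longrightarrow> rational (hsum [(0, x)] D)"
| isotopy: "rational D \<Longrightarrow> isotopic D D' \<Longrightarrow> rational D'"

text \<open>The horizontal lines between consecutive layers (including the bottom and the top line) cut a
  2-tangle diagram in points \<open>(k, j)\<close>: the \<open>j\<close>-th strand from the left, counted from 0, after the
  first \<open>k\<close> layers. An arc is represented by the set of the points lying on it.\<close>

fun strands :: "nat \<Rightarrow> layers \<Rightarrow> nat" where
  "strands m [] = m"
| "strands m ((i, p) # D) = strands (m - ins p + outs p) D"

definition points :: "layers \<Rightarrow> (nat \<times> nat) set" where
  "points D = {(k, j). k \<le> length D \<and> j < strands 2 (take k D)}"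

text \<open>Points that are joined within one layer; the two ends of an understrand are not.\<close>

inductive joined :: "layers \<Rightarrow> nat \<times> nat \<Rightarrow> nat \<times> nat \<Rightarrow> bool" for D where
  left: "k < length D \<Longrightarrow> D ! k = (i, p) \<Longrightarrow> j < i \<Longrightarrow> joined D (k, j) (k + 1, j)"
| right: "k < length D \<Longrightarrow> D ! k = (i, p) \<Longrightarrow> i + ins p + j < strands 2 (take k D) \<Longrightarrow>
    joined D (k, i + ins p + j) (k + 1, i + outs p + j)"
| cup: "k < length D \<Longrightarrow> D ! k = (i, Cup) \<Longrightarrow> joined D (k + 1, i) (k + 1, i + 1)"
| cap: "k < length D \<Longrightarrow> D ! k = (i, Cap) \<Longrightarrow> joined D (k, i) (k, i + 1)"
| over_right: "k < length D \<Longrightarrow> D ! k = (i, OverRight) \<Longrightarrow> joined D (k, i) (k + 1, i + 1)"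
| over_left: "k < length D \<Longrightarrow> D ! k = (i, OverLeft) \<Longrightarrow> joined D (k, i + 1) (k + 1, i)"

definition arc :: "layers \<Rightarrow> nat \<times> nat \<Rightarrow> (nat \<times> nat) set" where
  "arc D x = {y \<in> points D. equivclp (joined D) x y}"

definition arcs :: "layers \<Rightarrow> (nat \<times> nat) set set" where
  "arcs D = arc D ` points D"

text \<open>Assignments of complex numbers to the arcs, extended by 0 to sets of points that are not
  arcs, so that they form a subspace of the space of all functions.\<close>

definition colorings :: "layers \<Rightarrow> ((nat \<times> nat) set \<Rightarrow> complex) set" where
  "colorings D = {c.
     (\<forall>a. a \<notin> arcs D \<longrightarrow> c a = 0) \<and>
     (\<forall>k i. k < length D \<and> D ! k = (i, OverRight) \<longrightarrow>
        2 * c (arc D (k, i)) = c (arc D (k, i + 1)) + c (arc D (k + 1, i))) \<and>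
     (\<forall>k i. k < length D \<and> D ! k = (i, OverLeft) \<longrightarrow>
        2 * c (arc D (k, i + 1)) = c (arc D (k, i)) + c (arc D (k + 1, i + 1)))}"

text \<open>A span from \<open>\<complex>\<^sup>2\<close> to \<open>\<complex>\<^sup>2\<close> whose apex is a space of complex-valued functions.\<close>

record 'x span =
  apex :: "('x \<Rightarrow> complex) set"
  source_leg :: "('x \<Rightarrow> complex) \<Rightarrow> complex \<times> complex"
  target_leg :: "('x \<Rightarrow> complex) \<Rightarrow> complex \<times> complex"

definition linear_iso ::
  "(('x \<Rightarrow> complex) \<Rightarrow> ('y \<Rightarrow> complex)) \<Rightarrow> ('x \<Rightarrow> complex) set \<Rightarrow> ('y \<Rightarrow> complex) set \<Rightarrow> bool" where
  "linear_iso \<phi> Z Z' \<longleftrightarrow> bij_betw \<phi> Z Z' \<and>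
     (\<forall>u\<in>Z. \<forall>v\<in>Z. \<phi> (\<lambda>a. u a + v a) = (\<lambda>a. \<phi> u a + \<phi> v a)) \<and>
     (\<forall>s. \<forall>u\<in>Z. \<phi> (\<lambda>a. s * u a) = (\<lambda>a. s * \<phi> u a))"

definition span_equivalent :: "'x span \<Rightarrow> 'y span \<Rightarrow> bool" where
  "span_equivalent S S' \<longleftrightarrow> (\<exists>\<phi>. linear_iso \<phi> (apex S) (apex S') \<and>
     (\<forall>z\<in>apex S. source_leg S z = source_leg S' (\<phi> z) \<and> target_leg S z = target_leg S' (\<phi> z)))"

definition alexander_span :: "layers \<Rightarrow> (nat \<times> nat) set span" where
  "alexander_span D = \<lparr>
     apex = colorings D,
     source_leg = (\<lambda>c. (c (arc D (0, 0)), c (arc D (0, 1)))),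
     target_leg = (\<lambda>c. (c (arc D (length D, 0)), c (arc D (length D, 1))))\<rparr>"

end

theory Submission
  imports Defs
begin

text \<open>Twisting the four pairs of adjacent endpoints gives operators on isotopy classes of 2-tangles.
  Twists of adjacent sides satisfy braid relations, twists of opposite sides commute. Rational tangles
  form the orbit of \<open>[\<infinity>]\<close>. On this orbit left and right twists agree, and so do top and bottom twists,
  because the relevant quotients generate a normal subgroup that fixes the base point. The Euclidean
  algorithm then shows that the class of a rational tangle is determined by its fraction. Conversely the
  colourings of a rational tangle are determined by their boundary values, and these form a plane in
  \<open>\<complex>\<^sup>4\<close> from which the fraction can be read off; so equivalence of spans amounts to
  equality of fractions.\<close>

section \<open>Actions of braid groups\<close>

text \<open>Conway's classification is not presupposed: a normal form shows that the fraction
  determines the class, and the boundary values of colourings, which are isotopy invariant, recover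
  the fraction. The obstacle in the first half is that left and right twists need not agree outside
  the rational tangles. The classical argument rotates the tangle in space (flypes). Here it is
  algebraic: twists \<open>a\<close>, \<open>c\<close> of opposite sides and a twist
  \<open>b\<close> of an adjacent side act as the braid group on four strands. Identifying
  \<open>a\<close> with \<open>c\<close> maps it onto the braid group on three strands, and the
  kernel is free on \<open>u\<close> and \<open>w\<close>, the elements used below; so only these
  two have to be tested, at one tangle. The obstacle in the second half is that the two legs of a
  span need not be jointly injective, since a closed component adds a free colour. Therefore two
  things are carried through the moves: the set of boundary values, and the property that boundary
  values determine the colouring. For rational tangles both are known, and the span amounts to a
  subspace of \<open>\<complex>\<^sup>4\<close>.\<close>

locale braid_action =
  fixes a a' b b' :: "'x \<Rightarrow> 'x"
  assumes a_inv [simp]: "a (a' x) = x" "a' (a x) = x"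
    and b_inv [simp]: "b (b' x) = x" "b' (b x) = x"
    and braid: "a (b (a x)) = b (a (b x))"
begin

inductive orbit :: "'x \<Rightarrow> 'x \<Rightarrow> bool" for z where
  base: "orbit z z"
| a: "orbit z x \<Longrightarrow> orbit z (a x)"
| a': "orbit z x \<Longrightarrow> orbit z (a' x)"
| b: "orbit z x \<Longrightarrow> orbit z (b x)"
| b': "orbit z x \<Longrightarrow> orbit z (b' x)"

lemma braid': "a' (b (a x)) = b (a (b' x))" "a' (b' (a' x)) = b' (a' (b' x))"
  "b' (a (b x)) = a (b (a' x))"
  by (metis a_inv b_inv braid)+

lemma braid'': "b (a' (b' x)) = a' (b' (a x))"
  using braid'(3)[of "b' x"] by (metis a_inv(2) b_inv(1))

text \<open>In the braid group on three generators \<open>a\<close>, \<open>b\<close>, \<open>c\<close> the elements \<open>u = a c\<^sup>-\<^sup>1\<close> and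
  \<open>w = b u b\<^sup>-\<^sup>1\<close> generate a normal subgroup. Hence if they fix one point, they fix its whole orbit.\<close>

lemma orbit_coincide:
  assumes inv: "\<And>x. c (c' x) = x" "\<And>x. c' (c x) = x"
    and cbraid: "\<And>x. c (b (c x)) = b (c (b x))"
    and comm: "\<And>x. a (c x) = c (a x)"
    and base: "c z = a z" "c (b' z) = a (b' z)"
    and "orbit z x"
  shows "c x = a x"
proof -
  interpret c: braid_action c c' b b'
    using inv cbraid by unfold_locales auto
  have comm': "c' (a x) = a (c' x)" "c' (a' x) = a' (c' x)" "c (a' x) = a' (c x)" for x
    by (metis a_inv inv comm)+
  define u where "u = (\<lambda>x. a (c' x))"
  define w where "w = (\<lambda>x. b (u (b' x)))"
  define u' where "u' = (\<lambda>x. c (a' x))"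
  define w' where "w' = (\<lambda>x. b (u' (b' x)))"
  note defs = w_def w'_def u_def u'_def
  have u_inv: "u' (u x) = x" "u (u' x) = x" and w_inv: "w' (w x) = x" for x
    by (simp_all add: defs inv)
  \<comment> \<open>The equations from \<open>ua\<close> to \<open>wb'\<close> move \<open>u\<close>
    and \<open>w\<close> inwards past \<open>a\<close>, \<open>a'\<close>, \<open>b\<close> and
    \<open>b'\<close>, leaving a word in \<open>u\<close>, \<open>w\<close> and their inverses:
    normality, checked on generators. If \<open>u\<close> and \<open>w\<close> fix \<open>x\<close>,
    they fix its four images.\<close>
  have ua: "u (a x) = a (u x)" "u (a' x) = a' (u x)" for x
    by (simp_all add: defs comm' inv)
  have wa: "w (a x) = a (w (u x))" for x
  proof -
    have "a (w (u x)) = b (a (b (c' (b' (a (c' x))))))"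
      by (simp add: defs braid)
    also have "\<dots> = b (a (c' (b' (c (a (c' x))))))"
      by (simp only: c.braid'')
    also have "\<dots> = w (a x)"
      by (simp add: defs comm[symmetric] inv)
    finally show ?thesis ..
  qed
  have wa': "w (a' x) = a' (w (u' x))" for x
  proof -
    have "a' (w (u' x)) = b (a (b' (c' (b' (c (a' x))))))"
      by (simp add: defs braid')
    also have "\<dots> = w (a' x)"
      by (simp add: defs c.braid'(2)[symmetric] inv)
    finally show ?thesis ..
  qed
  have wb: "w (b x) = b (u x)" and ub': "u (b' x) = b' (w x)" for x
    by (simp_all add: defs)
  have ub: "u (b x) = b (u (w' (u x)))" for x
  proof -
    have "b (u (w' (u x))) = b (a (c' (b (c (a' (b' (a (c' x))))))))"
      by (simp add: defs)
    also have "\<dots> = b (a (b (c (b' (a' (b' (a (c' x))))))))"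
      by (simp add: c.braid')
    also have "\<dots> = a (b (a (c (a' (b' (a' (a (c' x))))))))"
      by (simp only: braid braid')
    also have "\<dots> = a (b (c (b' (c' x))))"
      by (simp add: comm)
    also have "\<dots> = u (b x)"
      by (simp add: defs inv c.braid'(1)[symmetric])
    finally show ?thesis ..
  qed
  have wb': "w (b' x) = b' (w (u' (w x)))" for x
  proof -
    have "b' (w (u' (w x))) = a (c' (b' (c (a' (b (a (c' (b' x))))))))"
      by (simp add: defs)
    also have "\<dots> = a (b (c' (b' (b (a (b' (c' (b' x))))))))"
      by (simp add: c.braid' braid')
    also have "\<dots> = a (b (a (c' (b' (c' (b' x))))))"
      by (simp add: comm')
    also have "\<dots> = b (a (b (b' (c' (b' (b' x))))))"
      by (simp only: braid c.braid')
    also have "\<dots> = w (b' x)"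
      by (simp add: defs)
    finally show ?thesis ..
  qed
  have fixed: "u' y = y" "w' y = y" if "u y = y" "w y = y" for y
    using that u_inv w_inv by metis+
  have coincide: "c' y = a' y \<longleftrightarrow> u y = y" for y
    unfolding u_def by (metis a_inv)
  have "u x = x \<and> w x = x"
    using \<open>orbit z x\<close>
  proof induction
    case base
    \<comment> \<open>The base hypotheses say that \<open>u\<close> fixes \<open>z\<close> and
      \<open>b' z\<close>; the latter means that \<open>w\<close> fixes \<open>z\<close>.\<close>
    have "a (c' z) = z" "a (c' (b' z)) = b' z"
      using assms(5,6) by (metis comm' inv(2))+
    then show ?case by (simp add: defs)
  qed (use fixed in \<open>simp_all add: ua wa wa' wb ub ub' wb'\<close>)
  then show ?thesis
    unfolding u_def by (metis comm' inv(1))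
qed

end

section \<open>The Euclidean algorithm as a normal form for orbits\<close>

lemma euclid_induct [consumes 1, case_names zero infinity add_left add_right]:
  fixes p q :: nat
  assumes "0 < p + q"
    and "\<And>q. 0 < q \<Longrightarrow> P 0 q" and "\<And>p. 0 < p \<Longrightarrow> P p 0"
    and "\<And>p q. 0 < q \<Longrightarrow> P p q \<Longrightarrow> P (p + q) q"
    and "\<And>p q. 0 < p \<Longrightarrow> P p q \<Longrightarrow> P p (p + q)"
  shows "P p q"
  using assms(1)
proof (induction "p + q" arbitrary: p q rule: less_induct)
  case less
  consider "p = 0" | "q = 0" | "0 < q" "q \<le> p" | "0 < p" "p \<le> q"
    by linarith
  then show ?case
  proof cases
    case 3
    then show ?thesis using less assms(4)[of q "p - q"] by simp
  next
    case 4
    then show ?thesis using less assms(5)[of p "q - p"] by simp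
  qed (use less.prems assms in auto)
qed

text \<open>\<open>I\<close> and \<open>Z\<close> play the role of the fractions \<open>\<infinity>\<close> and \<open>0\<close>; \<open>a\<close> and \<open>b\<close> act on fractions by
  \<open>r \<mapsto> r + 1\<close> and \<open>r \<mapsto> r / (1 - r)\<close>.\<close>

locale fraction_action = braid_action +
  fixes I Z :: 'a
  assumes a_I: "a I = I" and b_Z: "b Z = Z" and a_Z: "a Z = b' I" "a' Z = b I"
begin

text \<open>The subtractive Euclidean algorithm on \<open>(p, q)\<close> read as a word applied to
  \<open>I\<close> or \<open>Z\<close>: the point of fraction p/q, and for \<open>neg\<close> that
  of -p/q. The sign is split off so that the recursion stays in the natural numbers.\<close>

fun pos :: "nat \<Rightarrow> nat \<Rightarrow> 'a" where
  "pos p q = (if q = 0 then I else if p = 0 then Z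
    else if q \<le> p then a (pos (p - q) q) else b' (pos p (q - p)))"

fun neg :: "nat \<Rightarrow> nat \<Rightarrow> 'a" where
  "neg p q = (if q = 0 then I else if p = 0 then Z
    else if q \<le> p then a' (neg (p - q) q) else b (neg p (q - p)))"

declare pos.simps [simp del] neg.simps [simp del]

lemma a'_I: "a' I = I" and b'_Z: "b' Z = Z"
  using a_I b_Z by (metis a_inv b_inv)+

lemma pos_axes [simp]: "pos p 0 = I" "0 < q \<Longrightarrow> pos 0 q = Z"
  and neg_axes [simp]: "neg p 0 = I" "0 < q \<Longrightarrow> neg 0 q = Z"
  by (simp_all add: pos.simps neg.simps)

lemma pos_add_left: "pos (p + q) q = a (pos p q)"
  and neg_add_left: "neg (p + q) q = a' (neg p q)"
  using a_I a'_I by (simp_all add: pos.simps[of "p + q"] neg.simps[of "p + q"])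

text \<open>At a tie \<open>p = q\<close> the recursion chooses \<open>a\<close>. That
  \<open>b'\<close> does as well is the case \<open>q = 0\<close> here, and it is the axiom
  \<open>a Z = b' I\<close>. The pair (0, 0) is excluded because it denotes \<open>I\<close>, which
  \<open>b'\<close> need not fix.\<close>

lemma pos_add_right: "0 < p + q \<Longrightarrow> pos p (p + q) = b' (pos p q)"
  and neg_add_right: "0 < p + q \<Longrightarrow> neg p (p + q) = b (neg p q)"
proof -
  assume "0 < p + q"
  then consider "p = 0" "0 < q" | "q = 0" "0 < p" | "0 < p" "0 < q"
    by linarith
  then have "pos p (p + q) = b' (pos p q) \<and> neg p (p + q) = b (neg p q)"
  proof cases
    case 1
    then show ?thesis by (simp add: b_Z b'_Z)
  next
    case 2
    then show ?thesis by (simp add: pos.simps[of p p] neg.simps[of p p] a_Z)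
  next
    case 3
    then show ?thesis by (simp add: pos.simps[of p "p + q"] neg.simps[of p "p + q"])
  qed
  then show "pos p (p + q) = b' (pos p q)" "neg p (p + q) = b (neg p q)"
    by simp_all
qed

text \<open>\<open>aba\<close> is the quarter turn \<open>r \<mapsto> - 1 / r\<close>.\<close>

lemma quarter_turn:
  "0 < p + q \<Longrightarrow> pos p q = a (b (a (neg q p))) \<and> neg q p = a (b (a (pos p q)))"
proof (induction rule: euclid_induct)
  case (zero q)
  then show ?case by (simp add: a_I a_Z(1) flip: a_Z(2))
next
  case (infinity p)
  then show ?case by (simp add: a_I a_Z(1) flip: a_Z(2))
next
  case (add_left p q)
  have "neg q (p + q) = b (neg q p)"
    using add_left.hyps neg_add_right[of q p] by (simp add: add.commute)
  \<comment> \<open>Conjugation by \<open>aba\<close> exchanges \<open>a\<close> and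
    \<open>b\<close>, so it carries a Euclidean step of \<open>pos\<close> in one argument to the
    step of \<open>neg\<close> in the other.\<close>
  moreover have "a (b (a (b x))) = a (a (b (a x)))" "b (a (b (a x))) = a (b (a (a x)))" for x
    by (simp_all add: braid)
  ultimately show ?case using add_left.IH by (metis pos_add_left)
next
  case (add_right p q)
  have "pos p (p + q) = b' (pos p q)" "neg (p + q) p = a' (neg q p)"
    using add_right.hyps pos_add_right[of p q] neg_add_left[of q p] by (simp_all add: add.commute)
  moreover have "b' (a (b (a x))) = a (b (a (a' x)))" "a' (a (b (a x))) = a (b (a (b' x)))" for x
    by (metis a_inv b_inv braid)+
  ultimately show ?case using add_right.IH by metis
qed

text \<open>The points of reduced fractions are closed under the four operators. An operator
  prolongs the Euclidean word or cancels its outermost letter, except where the sign changes, as in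
  p/q - 1 with p < q; there \<open>quarter_turn\<close> rewrites the word.\<close>

lemma orbit_cases:
  assumes "orbit I x"
  obtains p q where "coprime p q" "x = pos p q" | p q where "coprime p q" "x = neg p q"
proof -
  define F where "F = {x. \<exists>p q. coprime p q \<and> (x = pos p q \<or> x = neg p q)}"
  have cop: "coprime (p + q) q \<longleftrightarrow> coprime p q" "coprime p (p + q) \<longleftrightarrow> coprime p q"
    for p q :: nat by (simp_all add: coprime_iff_gcd_eq_1)
  have pos_F: "pos p q \<in> F" and neg_F: "neg p q \<in> F" if "coprime p q" for p q
    using that unfolding F_def by blast+
  have a_pos: "a (pos p q) \<in> F" and a'_neg: "a' (neg p q) \<in> F"
    and b'_pos: "b' (pos p q) \<in> F" and b_neg: "b (neg p q) \<in> F" if pq: "coprime p q" for p q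
  proof -
    have 0: "0 < p + q" using pq by (cases "p = 0") auto
    show "a (pos p q) \<in> F" "a' (neg p q) \<in> F"
      using pos_F[of "p + q" q] neg_F[of "p + q" q] pq
      by (simp_all only: pos_add_left neg_add_left cop)
    show "b' (pos p q) \<in> F" "b (neg p q) \<in> F"
      using pos_F[of p "p + q"] neg_F[of p "p + q"] pq 0
      by (simp_all only: pos_add_right neg_add_right cop)
  qed
  have a'_pos: "a' (pos p q) \<in> F" and a_neg: "a (neg p q) \<in> F" if pq: "coprime p q" for p q
  proof -
    have "a' (pos p q) \<in> F \<and> a (neg p q) \<in> F"
    proof (cases "q \<le> p")
      case True
      then obtain r where p: "p = r + q" by (metis le_iff_add add.commute)
      have "coprime r q" using pq unfolding p cop .
      then show ?thesis
        using pos_F neg_F by (simp add: p pos_add_left neg_add_left)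
    next
      case False
      then obtain r where q: "q = p + r" and "0 < r"
        by (metis less_imp_add_positive not_le)
      then have 0: "0 < p + r" "0 < r + p" by simp_all
      have "coprime p r" using pq unfolding q cop .
      then have r: "coprime r (r + p)" by (metis cop coprime_commute)
      \<comment> \<open>In front of \<open>aba\<close> the word \<open>a' b'\<close> leaves just
        \<open>b\<close>. In fractions: p/(p + r) - 1 = -r/(p + r), and for the second equation 1 -
        p/(p + r) = r/(p + r).\<close>
      have "a' (b' (pos p r)) = b (neg r p)" "a (b (neg p r)) = b' (pos r p)"
        using quarter_turn[OF 0(1), THEN conjunct1] quarter_turn[OF 0(2), THEN conjunct1]
        by (simp_all add: braid)
      then have "a' (pos p q) = neg r (r + p)" "a (neg p q) = pos r (r + p)"
        unfolding q using 0 by (simp_all only: pos_add_right neg_add_right)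
      then show ?thesis using pos_F neg_F r by simp
    qed
    then show "a' (pos p q) \<in> F" "a (neg p q) \<in> F" by blast+
  qed
  have b_pos: "b (pos p q) \<in> F" and b'_neg: "b' (neg p q) \<in> F" if pq: "coprime p q" for p q
  proof -
    have "b (pos p q) \<in> F \<and> b' (neg p q) \<in> F"
    proof (cases "p \<le> q")
      case True
      then obtain r where q: "q = p + r" by (metis le_iff_add)
      have r: "coprime p r" using pq unfolding q cop .
      then have "0 < p + r" by (cases "p = 0") auto
      then show ?thesis
        using pos_F neg_F r by (simp only: q pos_add_right neg_add_right b_inv simp_thms)
    next
      case False
      then obtain r where p: "p = r + q" and "0 < r"
        by (metis add.commute less_imp_add_positive not_le)
      then have 0: "0 < q + r" "0 < r + q" by simp_all
      have "coprime r q" using pq unfolding p cop .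
      then have r: "coprime (q + r) r" by (metis cop coprime_commute)
      have "b (a (pos r q)) = a' (neg q r)" "b' (a' (neg r q)) = a (pos q r)"
        using quarter_turn[OF 0(1), THEN conjunct2] quarter_turn[OF 0(2), THEN conjunct2]
        by simp_all
      then have "b (pos p q) = neg (q + r) r" "b' (neg p q) = pos (q + r) r"
        by (simp_all only: p pos_add_left neg_add_left)
      then show ?thesis using pos_F neg_F r by simp
    qed
    then show "b (pos p q) \<in> F" "b' (neg p q) \<in> F" by blast+
  qed
  have closed: "a y \<in> F \<and> a' y \<in> F \<and> b y \<in> F \<and> b' y \<in> F" if "y \<in> F" for y
  proof -
    from that obtain p q where "coprime p q" "y = pos p q \<or> y = neg p q"
      unfolding F_def by blast
    then show ?thesis
      using a_pos a'_neg b'_pos b_neg a'_pos a_neg b_pos b'_neg by blast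
  qed
  from assms have "x \<in> F"
  proof induction
    case base
    then show ?case using pos_F[of 1 0] by simp
  qed (use closed in blast)+
  then show thesis using that unfolding F_def by blast
qed

end

section \<open>Isotopy of diagrams with arbitrary numbers of endpoints\<close>

lemma diagram_append:
  "diagram m (A @ B) n \<longleftrightarrow> diagram m A (strands m A) \<and> diagram (strands m A) B n"
  by (induction A arbitrary: m) auto

lemma diagram_strands: "diagram m D n \<Longrightarrow> strands m D = n"
  by (induction D arbitrary: m) auto

lemma strands_append: "strands m (A @ B) = strands (strands m A) B"
  by (induction A arbitrary: m) auto

lemma diagram_widen: "diagram m D n \<Longrightarrow> diagram (m + k) D (n + k)"
proof (induction D arbitrary: m)
  case (Cons l D)
  obtain i p where l: "l = (i, p)" by fastforce
  with Cons.prems have m: "i + ins p \<le> m" and D: "diagram (m - ins p + outs p) D n"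
    by auto
  from m have "m + k - ins p + outs p = (m - ins p + outs p) + k"
    by simp
  then show ?case using Cons.IH[OF D] m
    by (simp only: l diagram.simps) simp
qed auto

definition shift :: "nat \<Rightarrow> layers \<Rightarrow> layers" where
  "shift k = map (\<lambda>(i, p). (i + k, p))"

lemma shift_simps [simp]: "shift k [] = []" "shift k ((i, p) # D) = (i + k, p) # shift k D"
    "shift k (A @ B) = shift k A @ shift k B" "shift k (shift l D) = shift (k + l) D"
    "shift 0 D = D"
  by (auto simp: shift_def add_ac case_prod_unfold)

lemma diagram_shift: "diagram m D n \<Longrightarrow> diagram (m + k) (shift k D) (n + k)"
proof (induction D arbitrary: m)
  case (Cons l D)
  obtain i p where l: "l = (i, p)" by fastforce
  with Cons.prems have m: "i + ins p \<le> m" and D: "diagram (m - ins p + outs p) D n"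
    by auto
  from m have "m + k - ins p + outs p = (m - ins p + outs p) + k"
    by simp
  then show ?case using Cons.IH[OF D] m
    by (simp only: l diagram.simps shift_simps) simp
qed auto

text \<open>Endpoint numbers other than 2 are needed because a horizontal sum has four strands in
  its interior, where isotopies are carried out before being put into context.\<close>

definition iso_step :: "nat \<Rightarrow> nat \<Rightarrow> layers \<Rightarrow> layers \<Rightarrow> bool" where
  "iso_step m n D E \<longleftrightarrow> diagram m D n \<and> diagram m E n \<and>
     (\<exists>A L R B. move L R \<and> D = A @ L @ B \<and> E = A @ R @ B)"

text \<open>\<open>equivclp\<close> alone is reflexive on every list of layers; the first conjunct
  makes this a partial equivalence relation whose domain is the diagrams from \<open>m\<close> to
  \<open>n\<close> strands.\<close>

definition iso :: "nat \<Rightarrow> nat \<Rightarrow> layers \<Rightarrow> layers \<Rightarrow> bool" where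
  "iso m n D E \<longleftrightarrow> diagram m D n \<and> equivclp (iso_step m n) D E"

lemma isotopic_iff_iso: "two_tangle D \<Longrightarrow> isotopic D E \<longleftrightarrow> iso 2 2 D E"
proof -
  have "step = iso_step 2 2"
    by (intro ext) (simp add: step_def iso_step_def)
  then show "two_tangle D \<Longrightarrow> ?thesis"
    by (simp add: isotopic_def iso_def)
qed

lemma equivclp_iso_step_diagram:
  "equivclp (iso_step m n) D E \<Longrightarrow> diagram m D n \<longleftrightarrow> diagram m E n"
  by (induction rule: equivclp_induct) (auto simp: iso_step_def)

lemma iso_diagram: "iso m n D E \<Longrightarrow> diagram m D n" "iso m n D E \<Longrightarrow> diagram m E n"
  using equivclp_iso_step_diagram by (auto simp: iso_def)

lemma iso_refl: "diagram m D n \<Longrightarrow> iso m n D D"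
  by (simp add: iso_def)

lemma iso_sym [sym]: "iso m n D E \<Longrightarrow> iso m n E D"
  using equivclp_iso_step_diagram by (auto simp: iso_def intro: equivclp_sym)

lemma iso_trans [trans]: "iso m n D E \<Longrightarrow> iso m n E F \<Longrightarrow> iso m n D F"
  by (auto simp: iso_def intro: equivclp_trans)

lemma iso_map:
  assumes "iso m n D E"
    and "\<And>D E. iso_step m n D E \<Longrightarrow> iso m' n' (f D) (f E)"
    and "\<And>D. diagram m D n \<Longrightarrow> diagram m' (f D) n'"
  shows "iso m' n' (f D) (f E)"
proof -
  from assms(1) have "equivclp (iso_step m n) D E" and D: "diagram m D n"
    by (auto simp: iso_def)
  then show ?thesis
  proof (induction rule: equivclp_induct)
    case base
    then show ?case using assms(3) iso_refl by blast
  next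
    case (step E F)
    then show ?case
      using assms(2) iso_trans iso_sym by metis
  qed
qed

lemma iso_step_iso: "iso_step m n D E \<Longrightarrow> iso m n D E"
  using r_into_equivclp[of "iso_step m n" D E] unfolding iso_def by (simp add: iso_step_def)

lemma iso_moveI:
  assumes "move L R" and "D = A @ L @ B" and "E = A @ R @ B" and "diagram m D n" and "diagram m E n"
  shows "iso m n D E"
  using assms unfolding iso_step_def by (intro iso_step_iso) (unfold iso_step_def, blast)

lemma iso_append_context:
  assumes "iso k l L R" and "diagram m A k" and "diagram l B n"
  shows "iso m n (A @ L @ B) (A @ R @ B)"
proof (rule iso_map[OF assms(1), where f = "\<lambda>L. A @ L @ B"])
  have ctx: "diagram m (A @ D @ B) n" if "diagram k D l" for D
    using that assms(2,3) by (auto simp: diagram_append diagram_strands)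
  then show "diagram m (A @ D @ B) n" if "diagram k D l" for D
    using that .
  fix D E assume *: "iso_step k l D E"
  then obtain A' L' R' B' where "move L' R'" "D = A' @ L' @ B'" "E = A' @ R' @ B'"
    unfolding iso_step_def by blast
  then show "iso m n (A @ D @ B) (A @ E @ B)"
    using ctx[of D] ctx[of E] *[unfolded iso_step_def]
    by (intro iso_moveI[of L' R' _ "A @ A'" "B' @ B"]) auto
qed

lemma iso_contextI:
  assumes "iso k l L R" and "D = A @ L @ B" and "E = A @ R @ B"
    and "diagram m A k" and "diagram l B n"
  shows "iso m n D E"
  using iso_append_context[OF assms(1,4,5)] assms(2,3) by simp

lemma move_shift: "move L R \<Longrightarrow> move (shift k L) (shift k R)"
proof (induction rule: move.induct)
  case (far i p l q)
  show ?case using move.far[of "i + k" p l q] by (simp add: add_ac)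
next
  case (zigzag_left i)
  show ?case using move.zigzag_left[of "i + k"] by (simp add: add_ac)
next
  case (zigzag_right i)
  show ?case using move.zigzag_right[of "i + k"] by (simp add: add_ac)
next
  case (swing_cap_under i)
  show ?case using move.swing_cap_under[of "i + k"] by (simp add: add_ac)
next
  case (swing_cap_over i)
  show ?case using move.swing_cap_over[of "i + k"] by (simp add: add_ac)
next
  case (swing_cup_over i)
  show ?case using move.swing_cup_over[of "i + k"] by (simp add: add_ac)
next
  case (swing_cup_under i)
  show ?case using move.swing_cup_under[of "i + k"] by (simp add: add_ac)
next
  case (reidemeister1_cap x i)
  then show ?case using move.reidemeister1_cap[of x "i + k"] by (simp add: add_ac)
next
  case (reidemeister1_cup x i)
  then show ?case using move.reidemeister1_cup[of x "i + k"] by (simp add: add_ac)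
next
  case (reidemeister2_right i)
  show ?case using move.reidemeister2_right[of "i + k"] by (simp add: add_ac)
next
  case (reidemeister2_left i)
  show ?case using move.reidemeister2_left[of "i + k"] by (simp add: add_ac)
next
  case (reidemeister3 x i)
  then show ?case using move.reidemeister3[of x "i + k"] by (simp add: add_ac)
qed

lemma iso_shift: "iso m n D E \<Longrightarrow> iso (m + k) (n + k) (shift k D) (shift k E)"
proof (erule iso_map)
  fix D E assume *: "iso_step m n D E"
  then obtain A L R B where "move L R" "D = A @ L @ B" "E = A @ R @ B"
    unfolding iso_step_def by blast
  then show "iso (m + k) (n + k) (shift k D) (shift k E)"
    using * diagram_shift[of m D n k] diagram_shift[of m E n k]
    by (intro iso_moveI[of "shift k L" "shift k R" _ "shift k A" "shift k B"] move_shift)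
      (auto simp: iso_step_def)
qed (rule diagram_shift)

lemma iso_widen: "iso m n D E \<Longrightarrow> iso (m + k) (n + k) D E"
proof (erule iso_map[where f = "\<lambda>D. D"])
  fix D E assume "iso_step m n D E"
  then show "iso (m + k) (n + k) D E"
    by (intro iso_step_iso) (auto simp: iso_step_def diagram_widen)
qed (rule diagram_widen)

section \<open>Sliding a piece past a whole diagram\<close>

lemma iso_far:
  assumes "i + ins p + k + ins q \<le> m"
  shows "iso m (m - ins p + outs p - ins q + outs q)
    [(i, p), (i + outs p + k, q)] [(i + ins p + k, q), (i, p)]"
  using assms by (intro iso_moveI[OF move.far, of _ "[]" i p k q "[]"]) auto

text \<open>Iterated \<open>far\<close> moves: \<open>q\<close> acts on the \<open>w\<close> strands
  to the right of \<open>D\<close>. Its offset \<open>k\<close> is counted from the right edge of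
  \<open>D\<close>, so its index is \<open>n + k\<close> above \<open>D\<close> but
  \<open>m + k\<close> below.\<close>

lemma slide_right:
  assumes "diagram m D n" and "k + ins q \<le> w"
  shows "iso (m + w) (n + w - ins q + outs q) (D @ [(n + k, q)]) ((m + k, q) # D)"
  using assms(1)
proof (induction D arbitrary: m)
  case Nil
  then show ?case using assms(2) by (auto intro!: iso_refl)
next
  case (Cons l D)
  obtain i p where l: "l = (i, p)" by fastforce
  define m' where "m' = m - ins p + outs p"
  from Cons.prems l have i: "i + ins p \<le> m" and D: "diagram m' D n"
    by (auto simp: m'_def)
  have "iso (m + w) (n + w - ins q + outs q) ([(i, p)] @ (D @ [(n + k, q)]) @ [])
      ([(i, p)] @ ((m' + k, q) # D) @ [])"
    using i by (intro iso_append_context[OF Cons.IH[OF D]]) (auto simp: m'_def)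
  also have "iso (m + w) (n + w - ins q + outs q) \<dots> ((m + k, q) # l # D)"
  proof (rule iso_contextI)
    show "iso (m + w) (m + w - ins p + outs p - ins q + outs q)
        [(i, p), (i + outs p + (m - ins p - i + k), q)] [(i + ins p + (m - ins p - i + k), q), (i, p)]"
      using i assms(2) by (intro iso_far) auto
    show "[(i, p)] @ ((m' + k, q) # D) @ [] =
        [] @ [(i, p), (i + outs p + (m - ins p - i + k), q)] @ D"
      using i by (auto simp: m'_def)
    show "(m + k, q) # l # D = [] @ [(i + ins p + (m - ins p - i + k), q), (i, p)] @ D"
      using i l by auto
    show "diagram (m + w - ins p + outs p - ins q + outs q) D (n + w - ins q + outs q)"
      using diagram_widen[OF D, of "w - ins q + outs q"] i assms(2)
      by (simp add: m'_def add_ac)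
  qed simp
  finally show ?case using l by simp
qed

text \<open>Here \<open>D\<close> is renumbered: it stands to the right of \<open>q\<close>, which
  changes the number of strands on its left from \<open>i + ins q + k\<close> to
  \<open>i + outs q + k\<close>.\<close>

lemma slide_left:
  assumes "diagram m D n"
  shows "iso (i + ins q + k + m) (i + outs q + k + n)
    ((i, q) # shift (i + outs q + k) D) (shift (i + ins q + k) D @ [(i, q)])"
  using assms
proof (induction D arbitrary: m)
  case Nil
  then show ?case by (auto intro!: iso_refl)
next
  case (Cons l D)
  obtain j p where l: "l = (j, p)" by fastforce
  define m' where "m' = m - ins p + outs p"
  from Cons.prems l have j: "j + ins p \<le> m" and D: "diagram m' D n"
    by (auto simp: m'_def)
  have "iso (i + ins q + k + m) (i + outs q + k + n) ((i, q) # shift (i + outs q + k) (l # D))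
      ([(j + (i + ins q + k), p), (i, q)] @ shift (i + outs q + k) D)"
  proof (rule iso_contextI)
    show "iso (i + ins q + k + m) (i + ins q + k + m - ins q + outs q - ins p + outs p)
        [(i, q), (i + outs q + (k + j), p)] [(i + ins q + (k + j), p), (i, q)]"
      using j by (intro iso_far) auto
    show "(i, q) # shift (i + outs q + k) (l # D) =
        [] @ [(i, q), (i + outs q + (k + j), p)] @ shift (i + outs q + k) D"
      by (auto simp: l)
    show "[(j + (i + ins q + k), p), (i, q)] @ shift (i + outs q + k) D =
        [] @ [(i + ins q + (k + j), p), (i, q)] @ shift (i + outs q + k) D"
      by auto
    show "diagram (i + ins q + k + m - ins q + outs q - ins p + outs p) (shift (i + outs q + k) D)
        (i + outs q + k + n)"
      using diagram_shift[OF D, of "i + outs q + k"] j by (simp add: m'_def add_ac)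
  qed simp
  also have "iso (i + ins q + k + m) (i + outs q + k + n) \<dots> (shift (i + ins q + k) (l # D) @ [(i, q)])"
  proof (rule iso_contextI)
    show "iso (i + ins q + k + m') (i + outs q + k + n)
      ((i, q) # shift (i + outs q + k) D) (shift (i + ins q + k) D @ [(i, q)])"
      by (rule Cons.IH[OF D])
    show "[(j + (i + ins q + k), p), (i, q)] @ shift (i + outs q + k) D =
        [(j + (i + ins q + k), p)] @ ((i, q) # shift (i + outs q + k) D) @ []"
      by simp
    show "shift (i + ins q + k) (l # D) @ [(i, q)] =
        [(j + (i + ins q + k), p)] @ (shift (i + ins q + k) D @ [(i, q)]) @ []"
      by (simp add: l)
    show "diagram (i + ins q + k + m) [(j + (i + ins q + k), p)] (i + ins q + k + m')"
      using j by (simp add: m'_def)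
  qed simp
  finally show ?case .
qed

section \<open>Relations between the four twists\<close>

text \<open>The direction of the overstrand becomes a truth value because two operations negate it:
  inverting a crossing by Reidemeister II, and swinging it past a maximum or minimum.\<close>

definition over :: "bool \<Rightarrow> piece" where
  "over r = (if r then OverRight else OverLeft)"

lemma ins_over [simp]: "ins (over r) = 2" and outs_over [simp]: "outs (over r) = 2"
  and crossing_over [simp]: "crossing (over r)"
  by (auto simp: over_def crossing_def)

lemma crossing_iff_over: "crossing x \<longleftrightarrow> (\<exists>r. x = over r)"
  by (auto simp: over_def crossing_def)

lemma move_swing_cap: "move [(i, over r), (i + 1, Cap)] [(i + 1, over (\<not> r)), (i, Cap)]"
  using swing_cap_under swing_cap_over by (cases r) (simp_all add: over_def)

lemma move_swing_cup: "move [(i + 1, Cup), (i, over r)] [(i, Cup), (i + 1, over (\<not> r))]"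
  using swing_cup_under swing_cup_over by (cases r) (simp_all add: over_def)

lemma move_reidemeister2: "move [(i, over r), (i, over (\<not> r))] []"
  using reidemeister2_right reidemeister2_left by (cases r) (simp_all add: over_def)

lemma diagram_2_add: "two_tangle D \<Longrightarrow> diagram 4 D 4" "two_tangle D \<Longrightarrow> diagram 6 D 6"
  using diagram_widen[of 2 D 2 2] diagram_widen[of 2 D 2 4] by simp_all

lemma diagram_shift_add: "two_tangle D \<Longrightarrow> diagram 4 (shift 2 D) 4"
  "two_tangle D \<Longrightarrow> diagram 6 (shift 4 D) 6" "two_tangle D \<Longrightarrow> diagram 6 (shift 2 D) 6"
  using diagram_shift[of 2 D 2 2] diagram_shift[of 2 D 2 4]
    diagram_widen[OF diagram_shift[of 2 D 2 2], of 2] by simp_all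

lemmas tangle_diagrams = diagram_2_add diagram_shift_add
  diagram_2_add[THEN diagram_strands] diagram_shift_add[THEN diagram_strands]
  diagram_strands[of 2 _ 2]

lemma hsum_eq: "hsum D E = (1, Cup) # D @ shift 2 E @ [(1, Cap)]"
  by (simp add: hsum_def shift_def)

declare One_nat_def [simp del] add_2_eq_Suc [simp del] add_2_eq_Suc' [simp del]

lemma two_tangle_hsum: "two_tangle D \<Longrightarrow> two_tangle E \<Longrightarrow> two_tangle (hsum D E)"
  by (simp add: hsum_eq diagram_append tangle_diagrams)

section \<open>The four twists and their swung forms\<close>

abbreviation right_twist :: "bool \<Rightarrow> layers \<Rightarrow> layers" where
  "right_twist r D \<equiv> hsum D [(0, over r)]"

abbreviation left_twist :: "bool \<Rightarrow> layers \<Rightarrow> layers" where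
  "left_twist r D \<equiv> hsum [(0, over r)] D"

abbreviation top_twist :: "bool \<Rightarrow> layers \<Rightarrow> layers" where
  "top_twist r D \<equiv> D @ [(0, over r)]"

abbreviation bottom_twist :: "bool \<Rightarrow> layers \<Rightarrow> layers" where
  "bottom_twist r D \<equiv> (0, over r) # D"

text \<open>The crossing is pulled around the closing cap. It then lies at position 1, between the
  top right end of \<open>D\<close> and its bottom right end bent up by the cup, next to position 0
  where top twists act. In this form relations between twists become relations between braid
  generators.\<close>

lemma right_twist_swing:
  assumes D: "two_tangle D"
  shows "iso 2 2 (right_twist r D) ((1, Cup) # D @ [(1, over (\<not> r)), (2, Cap)])"
  using D move_swing_cap[of 1 "\<not> r"]
  by (intro iso_moveI[of "[(1, over (\<not> r)), (2, Cap)]" "[(2, over r), (1, Cap)]",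
        THEN iso_sym, of _ "(1, Cup) # D" "[]"])
    (auto simp: hsum_eq diagram_append tangle_diagrams)

text \<open>The counterpart for use with bottom twists: the crossing slides down past
  \<open>D\<close> and is swung around the opening cup.\<close>

lemma right_twist_swing':
  assumes D: "two_tangle D"
  shows "iso 2 2 (right_twist r D) ((2, Cup) # (1, over (\<not> r)) # D @ [(1, Cap)])"
proof -
  have "iso 2 2 (right_twist r D) ((1, Cup) # (2, over r) # D @ [(1, Cap)])"
    using slide_right[OF D, of 0 "over r" 2] D
    by - (rule iso_contextI[of 4 4 "D @ [(2, over r)]" "(2, over r) # D" _ "[(1, Cup)]" "[(1, Cap)]"],
        simp_all add: hsum_eq)
  also have "iso 2 2 \<dots> ((2, Cup) # (1, over (\<not> r)) # D @ [(1, Cap)])"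
    using D move_swing_cup[of 1 "\<not> r"]
    by (intro iso_moveI[of "[(2, Cup), (1, over (\<not> r))]" "[(1, Cup), (2, over r)]",
          THEN iso_sym, of _ "[]" "D @ [(1, Cap)]"])
      (auto simp: diagram_append tangle_diagrams)
  finally show ?thesis .
qed

lemma left_twist_slide:
  assumes D: "two_tangle D"
  shows "iso 2 2 (left_twist r D) ((1, Cup) # shift 2 D @ [(0, over r), (1, Cap)])"
  using slide_left[OF D, of 0 "over r" 0] D
  by - (rule iso_contextI[of 4 4 "(0, over r) # shift 2 D" "shift 2 D @ [(0, over r)]" _
        "[(1, Cup)]" "[(1, Cap)]"], simp_all add: hsum_eq)

text \<open>Mirror image of \<open>right_twist_swing\<close>; the crossing starts below
  \<open>D\<close> and has to slide above it first.\<close>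

lemma left_twist_swing:
  assumes D: "two_tangle D"
  shows "iso 2 2 (left_twist r D) ((1, Cup) # shift 2 D @ [(1, over (\<not> r)), (0, Cap)])"
proof -
  note left_twist_slide[OF D]
  also have "iso 2 2 ((1, Cup) # shift 2 D @ [(0, over r), (1, Cap)])
      ((1, Cup) # shift 2 D @ [(1, over (\<not> r)), (0, Cap)])"
    using D move_swing_cap[of 0 r]
    by (intro iso_moveI[of "[(0, over r), (1, Cap)]" "[(1, over (\<not> r)), (0, Cap)]" _
          "(1, Cup) # shift 2 D" "[]"])
      (auto simp: diagram_append tangle_diagrams)
  finally show ?thesis .
qed

lemma right_twist_cong: "iso 2 2 D E \<Longrightarrow> iso 2 2 (right_twist r D) (right_twist r E)"
  using iso_widen[of 2 2 D E 2]
  by - (rule iso_contextI[of 4 4 D E _ "[(1, Cup)]" "[(2, over r), (1, Cap)]"],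
      simp_all add: hsum_eq)

lemma left_twist_cong: "iso 2 2 D E \<Longrightarrow> iso 2 2 (left_twist r D) (left_twist r E)"
  using iso_shift[of 2 2 D E 2]
  by - (rule iso_contextI[of 4 4 "shift 2 D" "shift 2 E" _ "[(1, Cup), (0, over r)]" "[(1, Cap)]"],
      simp_all add: hsum_eq)

lemma top_twist_cong: "iso 2 2 D E \<Longrightarrow> iso 2 2 (top_twist r D) (top_twist r E)"
  by - (rule iso_contextI[of 2 2 D E _ "[]" "[(0, over r)]"],
      simp_all)

lemma bottom_twist_cong: "iso 2 2 D E \<Longrightarrow> iso 2 2 (bottom_twist r D) (bottom_twist r E)"
  by - (rule iso_contextI[of 2 2 D E _ "[(0, over r)]" "[]"],
      simp_all)

lemma top_twist_cancel:
  "two_tangle D \<Longrightarrow> iso 2 2 (top_twist r (top_twist (\<not> r) D)) D"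
  using move_reidemeister2[of 0 "\<not> r"]
  by (intro iso_moveI[of "[(0, over (\<not> r)), (0, over r)]" "[]" _ D "[]"])
    (auto simp: diagram_append tangle_diagrams)

lemma bottom_twist_cancel:
  "two_tangle D \<Longrightarrow> iso 2 2 (bottom_twist r (bottom_twist (\<not> r) D)) D"
  using move_reidemeister2[of 0 "r"]
  by (intro iso_moveI[of "[(0, over r), (0, over (\<not> r))]" "[]" _ "[]" D])
    (auto simp: diagram_append tangle_diagrams)

text \<open>The cup of the outer twist, lifted past \<open>D\<close> and the inner crossing, forms a
  zigzag with the inner cap. So swung twists of one side multiply like crossings at position 1;
  since \<open>E\<close> is arbitrary, other twists may come in between.\<close>

lemma right_twist_straighten:
  assumes D: "two_tangle D" and E: "diagram 4 E 2"
  shows "iso 2 2 ((1, Cup) # (1, Cup) # D @ (1, over r) # (2, Cap) # E)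
    ((1, Cup) # D @ (1, over r) # E)"
proof -
  have "iso 2 2 ((1, Cup) # (1, Cup) # D @ (1, over r) # (2, Cap) # E)
      ((1, Cup) # (3, Cup) # D @ (1, over r) # (2, Cap) # E)"
    using D E far[of 1 Cup 0 Cup]
    by (intro iso_moveI[of "[(1, Cup), (3, Cup)]" "[(1, Cup), (1, Cup)]", THEN iso_sym, of _ "[]"
          "D @ (1, over r) # (2, Cap) # E"])
      (auto simp: diagram_append tangle_diagrams)
  also have "iso 2 2 \<dots> ((1, Cup) # D @ (3, Cup) # (1, over r) # (2, Cap) # E)"
    using D E iso_sym[OF slide_right[OF D, of 1 Cup 2]]
    by - (rule iso_contextI[of 4 6 "(3, Cup) # D" "D @ [(3, Cup)]" _ "[(1, Cup)]"
          "(1, over r) # (2, Cap) # E"], simp_all)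
  also have "iso 2 2 \<dots> ((1, Cup) # D @ (1, over r) # (3, Cup) # (2, Cap) # E)"
    using D E far[of 1 "over r" 0 Cup]
    by (intro iso_moveI[of "[(1, over r), (3, Cup)]" "[(3, Cup), (1, over r)]", THEN iso_sym,
          of _ "(1, Cup) # D" "(2, Cap) # E"])
      (auto simp: diagram_append tangle_diagrams)
  also have "iso 2 2 \<dots> ((1, Cup) # D @ (1, over r) # E)"
    using D E zigzag_right[of 2]
    by (intro iso_moveI[of "[(3, Cup), (2, Cap)]" "[]" _ "(1, Cup) # D @ [(1, over r)]" E])
      (auto simp: diagram_append tangle_diagrams)
  finally show ?thesis .
qed

text \<open>In the mirror image, nesting has shifted the inner twist by two positions; lifting the
  outer cup past the inner crossing brings that crossing from position 3 back to 1.\<close>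

lemma left_twist_straighten:
  assumes D: "two_tangle D" and E: "diagram 4 E 2"
  shows "iso 2 2 ((1, Cup) # (3, Cup) # shift 4 D @ (3, over r) # (2, Cap) # E)
    ((1, Cup) # shift 2 D @ (1, over r) # E)"
proof -
  have "iso 2 2 ((1, Cup) # (3, Cup) # shift 4 D @ (3, over r) # (2, Cap) # E)
      ((1, Cup) # (1, Cup) # shift 4 D @ (3, over r) # (2, Cap) # E)"
    using D E far[of 1 Cup 0 Cup]
    by (intro iso_moveI[of "[(1, Cup), (3, Cup)]" "[(1, Cup), (1, Cup)]", of _ "[]"
          "shift 4 D @ (3, over r) # (2, Cap) # E"])
      (auto simp: diagram_append tangle_diagrams)
  also have "iso 2 2 \<dots> ((1, Cup) # shift 2 D @ (1, Cup) # (3, over r) # (2, Cap) # E)"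
    using D E slide_left[OF D, of 1 Cup 1]
    by - (rule iso_contextI[of 4 6 "(1, Cup) # shift 4 D" "shift 2 D @ [(1, Cup)]" _ "[(1, Cup)]"
          "(3, over r) # (2, Cap) # E"], simp_all)
  also have "iso 2 2 \<dots> ((1, Cup) # shift 2 D @ (1, over r) # (1, Cup) # (2, Cap) # E)"
    using D E far[of 1 "Cup" 0 "over r"]
    by (intro iso_moveI[of "[(1, Cup), (3, over r)]" "[(1, over r), (1, Cup)]",
          of _ "(1, Cup) # shift 2 D" "(2, Cap) # E"])
      (auto simp: diagram_append tangle_diagrams)
  also have "iso 2 2 \<dots> ((1, Cup) # shift 2 D @ (1, over r) # E)"
    using D E zigzag_left[of 1]
    by (intro iso_moveI[of "[(1, Cup), (2, Cap)]" "[]" _ "(1, Cup) # shift 2 D @ [(1, over r)]" E])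
      (auto simp: diagram_append tangle_diagrams)
  finally show ?thesis .
qed

lemma right_twist_cancel:
  assumes D: "two_tangle D"
  shows "iso 2 2 (right_twist r (right_twist (\<not> r) D)) D"
proof -
  have "iso 2 2 (right_twist r (right_twist (\<not> r) D))
      (right_twist r ((1, Cup) # D @ [(1, over r), (2, Cap)]))"
    using right_twist_cong[OF right_twist_swing[OF D, of "\<not> r"]] by simp
  also have "iso 2 2 \<dots> ((1, Cup) # ((1, Cup) # D @ [(1, over r), (2, Cap)])
      @ [(1, over (\<not> r)), (2, Cap)])"
    using D by (intro right_twist_swing) (simp add: diagram_append tangle_diagrams)
  also have "iso 2 2 \<dots> ((1, Cup) # D @ [(1, over r), (1, over (\<not> r)), (2, Cap)])"
    using right_twist_straighten[OF D, of "[(1, over (\<not> r)), (2, Cap)]" r] by simp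
  also have "iso 2 2 \<dots> ((1, Cup) # D @ [(2, Cap)])"
    using D move_reidemeister2[of 1 r]
    by (intro iso_moveI[of "[(1, over r), (1, over (\<not> r))]" "[]" _ "(1, Cup) # D" "[(2, Cap)]"])
      (auto simp: diagram_append tangle_diagrams)
  also have "iso 2 2 \<dots> ((1, Cup) # (2, Cap) # D)"
    using D slide_right[OF D, of 0 Cap 2]
    by - (rule iso_contextI[of 4 2 "D @ [(2, Cap)]" "(2, Cap) # D" _ "[(1, Cup)]" "[]"],
        simp_all)
  also have "iso 2 2 \<dots> D"
    using D zigzag_left[of 1]
    by (intro iso_moveI[of "[(1, Cup), (2, Cap)]" "[]" _ "[]" D]) auto
  finally show ?thesis .
qed

lemma left_twist_cancel:
  assumes D: "two_tangle D"
  shows "iso 2 2 (left_twist r (left_twist (\<not> r) D)) D"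
proof -
  have "iso 2 2 (left_twist r (left_twist (\<not> r) D))
      (left_twist r ((1, Cup) # shift 2 D @ [(1, over r), (0, Cap)]))"
    using left_twist_cong[OF left_twist_swing[OF D, of "\<not> r"]] by simp
  also have "iso 2 2 \<dots> ((1, Cup) # shift 2 ((1, Cup) # shift 2 D @ [(1, over r), (0, Cap)])
      @ [(1, over (\<not> r)), (0, Cap)])"
    using D by (intro left_twist_swing) (simp add: diagram_append tangle_diagrams)
  also have "\<dots> = (1, Cup) # (3, Cup) # shift 4 D @ (3, over r) # (2, Cap) #
      [(1, over (\<not> r)), (0, Cap)]"
    by simp
  also have "iso 2 2 \<dots> ((1, Cup) # shift 2 D @ [(1, over r), (1, over (\<not> r)), (0, Cap)])"
    using left_twist_straighten[OF D, of "[(1, over (\<not> r)), (0, Cap)]" r] by simp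
  also have "iso 2 2 \<dots> ((1, Cup) # shift 2 D @ [(0, Cap)])"
    using D move_reidemeister2[of 1 r]
    by (intro iso_moveI[of "[(1, over r), (1, over (\<not> r))]" "[]" _ "(1, Cup) # shift 2 D" "[(0, Cap)]"])
      (auto simp: diagram_append tangle_diagrams)
  also have "iso 2 2 \<dots> ((1, Cup) # (0, Cap) # D)"
    using D iso_sym[OF slide_left[OF D, of 0 Cap 0]]
    by - (rule iso_contextI[of 4 2 "shift 2 D @ [(0, Cap)]" "(0, Cap) # D" _ "[(1, Cup)]" "[]"],
        simp_all)
  also have "iso 2 2 \<dots> D"
    using D zigzag_right[of 0]
    by (intro iso_moveI[of "[(1, Cup), (0, Cap)]" "[]" _ "[]" D]) auto
  finally show ?thesis .
qed

text \<open>Swung right twists are crossings at position 1 and top twists are crossings at position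
  0, so after straightening the two sides differ by Reidemeister III. Swinging negates the
  direction, whence \<open>r\<close> on the right and \<open>\<not> r\<close> on top.\<close>

lemma right_top_braid:
  assumes D: "two_tangle D"
  shows "iso 2 2 (right_twist r (top_twist (\<not> r) (right_twist r D)))
    (top_twist (\<not> r) (right_twist r (top_twist (\<not> r) D)))"
proof -
  let ?x = "over (\<not> r)"
  have "iso 2 2 (right_twist r (top_twist (\<not> r) (right_twist r D)))
      (right_twist r (top_twist (\<not> r) ((1, Cup) # D @ [(1, ?x), (2, Cap)])))"
    by (intro right_twist_cong top_twist_cong right_twist_swing D)
  also have "iso 2 2 \<dots>
      ((1, Cup) # (top_twist (\<not> r) ((1, Cup) # D @ [(1, ?x), (2, Cap)])) @ [(1, ?x), (2, Cap)])"
    using D by (intro right_twist_swing) (simp add: diagram_append tangle_diagrams)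
  also have "iso 2 2 \<dots> ((1, Cup) # D @ [(1, ?x), (0, ?x), (1, ?x), (2, Cap)])"
    using right_twist_straighten[OF D, of "[(0, ?x), (1, ?x), (2, Cap)]" "\<not> r"] by simp
  also have "iso 2 2 \<dots> ((1, Cup) # D @ [(0, ?x), (1, ?x), (0, ?x), (2, Cap)])"
    using D reidemeister3[of ?x 0]
    by (intro iso_moveI[of "[(0, ?x), (1, ?x), (0, ?x)]" "[(1, ?x), (0, ?x), (1, ?x)]",
        THEN iso_sym, of _ "(1, Cup) # D" "[(2, Cap)]"])
      (auto simp: diagram_append tangle_diagrams)
  also have "iso 2 2 \<dots> ((1, Cup) # D @ [(0, ?x), (1, ?x), (2, Cap), (0, ?x)])"
    using D far[of 0 ?x 0 Cap]
    by (intro iso_moveI[of "[(0, ?x), (2, Cap)]" "[(2, Cap), (0, ?x)]" _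
          "(1, Cup) # D @ [(0, ?x), (1, ?x)]" "[]"])
      (auto simp: diagram_append tangle_diagrams)
  also have "iso 2 2 \<dots> (top_twist (\<not> r) (right_twist r (top_twist (\<not> r) D)))"
    using D top_twist_cong[OF iso_sym[OF right_twist_swing[of "top_twist (\<not> r) D" r]]]
    by (simp add: diagram_append tangle_diagrams)
  finally show ?thesis .
qed

lemma left_top_braid:
  assumes D: "two_tangle D"
  shows "iso 2 2 (left_twist r (top_twist (\<not> r) (left_twist r D)))
    (top_twist (\<not> r) (left_twist r (top_twist (\<not> r) D)))"
proof -
  let ?x = "over (\<not> r)"
  have "iso 2 2 (left_twist r (top_twist (\<not> r) (left_twist r D)))
      (left_twist r (top_twist (\<not> r) ((1, Cup) # shift 2 D @ [(1, ?x), (0, Cap)])))"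
    by (intro left_twist_cong top_twist_cong left_twist_swing D)
  also have "iso 2 2 \<dots>
      ((1, Cup) # shift 2 (top_twist (\<not> r) ((1, Cup) # shift 2 D @ [(1, ?x), (0, Cap)]))
        @ [(1, ?x), (0, Cap)])"
    using D by (intro left_twist_swing) (simp add: diagram_append tangle_diagrams)
  also have "\<dots> = (1, Cup) # (3, Cup) # shift 4 D @ (3, ?x) # (2, Cap) #
      [(2, ?x), (1, ?x), (0, Cap)]"
    by simp
  also have "iso 2 2 \<dots> ((1, Cup) # shift 2 D @ [(1, ?x), (2, ?x), (1, ?x), (0, Cap)])"
    using left_twist_straighten[OF D, of "[(2, ?x), (1, ?x), (0, Cap)]" "\<not> r"] by simp
  also have "iso 2 2 \<dots> ((1, Cup) # shift 2 D @ [(2, ?x), (1, ?x), (2, ?x), (0, Cap)])"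
    using D reidemeister3[of ?x 1]
    by (intro iso_moveI[of "[(1, ?x), (2, ?x), (1, ?x)]" "[(2, ?x), (1, ?x), (2, ?x)]" _
          "(1, Cup) # shift 2 D" "[(0, Cap)]"])
      (auto simp: diagram_append tangle_diagrams)
  also have "iso 2 2 \<dots> ((1, Cup) # shift 2 D @ [(2, ?x), (1, ?x), (0, Cap), (0, ?x)])"
    using D far[of 0 Cap 0 ?x]
    by (intro iso_moveI[of "[(0, Cap), (0, ?x)]" "[(2, ?x), (0, Cap)]", THEN iso_sym,
        of _ "(1, Cup) # shift 2 D @ [(2, ?x), (1, ?x)]" "[]"])
      (auto simp: diagram_append tangle_diagrams)
  also have "iso 2 2 \<dots> (top_twist (\<not> r) (left_twist r (top_twist (\<not> r) D)))"
    using D top_twist_cong[OF iso_sym[OF left_twist_swing[of "top_twist (\<not> r) D" r]]]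
    by (simp add: diagram_append tangle_diagrams)
  finally show ?thesis .
qed

lemma right_bottom_braid:
  assumes D: "two_tangle D"
  shows "iso 2 2 (right_twist r (bottom_twist (\<not> r) (right_twist r D)))
    (bottom_twist (\<not> r) (right_twist r (bottom_twist (\<not> r) D)))"
proof -
  let ?x = "over (\<not> r)"
  have "iso 2 2 (right_twist r (bottom_twist (\<not> r) (right_twist r D)))
      (right_twist r (bottom_twist (\<not> r) ((2, Cup) # (1, ?x) # D @ [(1, Cap)])))"
    by (intro right_twist_cong bottom_twist_cong right_twist_swing' D)
  also have "iso 2 2 \<dots> ((2, Cup) # (1, ?x) #
      (bottom_twist (\<not> r) ((2, Cup) # (1, ?x) # D @ [(1, Cap)])) @ [(1, Cap)])"
    using D by (intro right_twist_swing') (simp add: diagram_append tangle_diagrams)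
  \<comment> \<open>The outer cap is lowered past \<open>D\<close> and the inner crossing until it
    forms a zigzag with the inner cup.\<close>
  also have "iso 2 2 \<dots> ((2, Cup) # (1, ?x) # (0, ?x) # (2, Cup) # (1, ?x) # D @ [(3, Cap), (1, Cap)])"
    using D far[of 1 Cap 0 Cap]
    by (intro iso_moveI[of "[(1, Cap), (1, Cap)]" "[(3, Cap), (1, Cap)]",
        of _ "(2, Cup) # (1, ?x) # (0, ?x) # (2, Cup) # (1, ?x) # D" "[]"])
      (auto simp: diagram_append tangle_diagrams)
  also have "iso 2 2 \<dots> ((2, Cup) # (1, ?x) # (0, ?x) # (2, Cup) # (1, ?x) # (3, Cap) # D @ [(1, Cap)])"
    using D slide_right[OF D, of 1 Cap 4]
    by - (rule iso_contextI[of 6 4 "D @ [(3, Cap)]" "(3, Cap) # D",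
        of _ "[(2, Cup), (1, ?x), (0, ?x), (2, Cup), (1, ?x)]" "[(1, Cap)]"],
      simp_all add: diagram_append tangle_diagrams)
  also have "iso 2 2 \<dots> ((2, Cup) # (1, ?x) # (0, ?x) # (2, Cup) # (3, Cap) # (1, ?x) # D @ [(1, Cap)])"
    using D far[of 1 ?x 0 Cap]
    by (intro iso_moveI[of "[(1, ?x), (3, Cap)]" "[(3, Cap), (1, ?x)]",
        of _ "[(2, Cup), (1, ?x), (0, ?x), (2, Cup)]" "D @ [(1, Cap)]"])
      (auto simp: diagram_append tangle_diagrams)
  also have "iso 2 2 \<dots> ((2, Cup) # (1, ?x) # (0, ?x) # (1, ?x) # D @ [(1, Cap)])"
    using D zigzag_left[of 2]
    by (intro iso_moveI[of "[(2, Cup), (3, Cap)]" "[]",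
        of _ "[(2, Cup), (1, ?x), (0, ?x)]" "(1, ?x) # D @ [(1, Cap)]"])
      (auto simp: diagram_append tangle_diagrams)
  also have "iso 2 2 \<dots> ((2, Cup) # (0, ?x) # (1, ?x) # (0, ?x) # D @ [(1, Cap)])"
    using D reidemeister3[of ?x 0]
    by (intro iso_moveI[of "[(0, ?x), (1, ?x), (0, ?x)]" "[(1, ?x), (0, ?x), (1, ?x)]",
        THEN iso_sym, of _ "[(2, Cup)]" "D @ [(1, Cap)]"])
      (auto simp: diagram_append tangle_diagrams)
  also have "iso 2 2 \<dots> ((0, ?x) # (2, Cup) # (1, ?x) # (0, ?x) # D @ [(1, Cap)])"
    using D far[of 0 ?x 0 Cup]
    by (intro iso_moveI[of "[(0, ?x), (2, Cup)]" "[(2, Cup), (0, ?x)]", THEN iso_sym,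
        of _ "[]" "(1, ?x) # (0, ?x) # D @ [(1, Cap)]"])
      (auto simp: diagram_append tangle_diagrams)
  also have "iso 2 2 \<dots> (bottom_twist (\<not> r) (right_twist r (bottom_twist (\<not> r) D)))"
    using D bottom_twist_cong[OF iso_sym[OF right_twist_swing'[of "bottom_twist (\<not> r) D" r]]]
    by (simp add: diagram_append tangle_diagrams)
  finally show ?thesis .
qed

text \<open>In swung form the two crossings occupy positions 1 and 3 of six strands, so it suffices
  to exchange heights of pieces lying side by side.\<close>

lemma right_left_commute:
  assumes D: "two_tangle D"
  shows "iso 2 2 (right_twist r (left_twist s D)) (left_twist s (right_twist r D))"
proof -
  let ?x = "over (\<not> r)" and ?y = "over (\<not> s)"
  have "iso 2 2 (right_twist r (left_twist s D))
      (right_twist r ((1, Cup) # shift 2 D @ [(1, ?y), (0, Cap)]))"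
    by (intro right_twist_cong left_twist_swing D)
  also have "iso 2 2 \<dots>
      ((1, Cup) # ((1, Cup) # shift 2 D @ [(1, ?y), (0, Cap)]) @ [(1, ?x), (2, Cap)])"
    using D by (intro right_twist_swing) (simp add: diagram_append tangle_diagrams)
  also have "iso 2 2 \<dots> ((1, Cup) # (3, Cup) # shift 2 D @ [(1, ?y), (0, Cap), (1, ?x), (2, Cap)])"
    using D far[of 1 Cup 0 Cup]
    by (intro iso_moveI[of "[(1, Cup), (3, Cup)]" "[(1, Cup), (1, Cup)]", THEN iso_sym,
          of _ "[]" "shift 2 D @ [(1, ?y), (0, Cap), (1, ?x), (2, Cap)]"])
      (auto simp: diagram_append tangle_diagrams)
  also have "iso 2 2 \<dots> ((1, Cup) # (3, Cup) # shift 2 D @ [(1, ?y), (3, ?x), (0, Cap), (2, Cap)])"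
    using D far[of 0 Cap 1 ?x]
    by (intro iso_moveI[of "[(0, Cap), (1, ?x)]" "[(3, ?x), (0, Cap)]",
          of _ "(1, Cup) # (3, Cup) # shift 2 D @ [(1, ?y)]" "[(2, Cap)]"])
      (auto simp: diagram_append tangle_diagrams)
  also have "iso 2 2 \<dots> ((1, Cup) # (3, Cup) # shift 2 D @ [(1, ?y), (3, ?x), (4, Cap), (0, Cap)])"
    using D far[of 0 Cap 2 Cap]
    by (intro iso_moveI[of "[(0, Cap), (2, Cap)]" "[(4, Cap), (0, Cap)]",
          of _ "(1, Cup) # (3, Cup) # shift 2 D @ [(1, ?y), (3, ?x)]" "[]"])
      (auto simp: diagram_append tangle_diagrams)
  also have "iso 2 2 \<dots> ((1, Cup) # (3, Cup) # shift 2 D @ [(3, ?x), (1, ?y), (4, Cap), (0, Cap)])"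
    using D far[of 1 ?y 0 ?x]
    by (intro iso_moveI[of "[(1, ?y), (3, ?x)]" "[(3, ?x), (1, ?y)]",
          of _ "(1, Cup) # (3, Cup) # shift 2 D" "[(4, Cap), (0, Cap)]"])
      (auto simp: diagram_append tangle_diagrams)
  also have "iso 2 2 \<dots> ((1, Cup) # (3, Cup) # shift 2 D @ [(3, ?x), (4, Cap), (1, ?y), (0, Cap)])"
    using D far[of 1 ?y 1 Cap]
    by (intro iso_moveI[of "[(1, ?y), (4, Cap)]" "[(4, Cap), (1, ?y)]",
          of _ "(1, Cup) # (3, Cup) # shift 2 D @ [(3, ?x)]" "[(0, Cap)]"])
      (auto simp: diagram_append tangle_diagrams)
  also have "iso 2 2 \<dots> (left_twist s ((1, Cup) # D @ [(1, ?x), (2, Cap)]))"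
    using D iso_sym[OF left_twist_swing[of "(1, Cup) # D @ [(1, ?x), (2, Cap)]" s]]
    by (simp add: diagram_append tangle_diagrams)
  also have "iso 2 2 \<dots> (left_twist s (right_twist r D))"
    by (intro left_twist_cong iso_sym[OF right_twist_swing[OF D]])
  finally show ?thesis .
qed

section \<open>Twists of [\<infinity>] and [0]\<close>

lemma right_twist_infinity: "iso 2 2 (right_twist r tangle_infinity) tangle_infinity"
proof -
  have "iso 2 2 (right_twist r []) [(1, Cup), (1, over (\<not> r)), (2, Cap)]"
    using right_twist_swing[of "[]" r] by simp
  also have "iso 2 2 \<dots> [(1, Cup), (2, Cap)]"
    using reidemeister1_cup[of "over (\<not> r)" 1] 
    by (intro iso_moveI[of "[(1, Cup), (1, over (\<not> r))]" "[(1, Cup)]" _ "[]" "[(2, Cap)]"]) auto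
  also have "iso 2 2 \<dots> []"
    using zigzag_left[of 1]
    by (intro iso_moveI[of "[(1, Cup), (2, Cap)]" "[]" _ "[]" "[]"]) auto
  finally show ?thesis by (simp add: tangle_infinity_def)
qed

lemma left_twist_infinity: "iso 2 2 (left_twist r tangle_infinity) tangle_infinity"
proof -
  have "iso 2 2 (left_twist r []) [(1, Cup), (1, over (\<not> r)), (0, Cap)]"
    using left_twist_swing[of "[]" r] by simp
  also have "iso 2 2 \<dots> [(1, Cup), (0, Cap)]"
    using reidemeister1_cup[of "over (\<not> r)" 1] 
    by (intro iso_moveI[of "[(1, Cup), (1, over (\<not> r))]" "[(1, Cup)]" _ "[]" "[(0, Cap)]"]) auto
  also have "iso 2 2 \<dots> []"
    using zigzag_right[of 0]
    by (intro iso_moveI[of "[(1, Cup), (0, Cap)]" "[]" _ "[]" "[]"]) auto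
  finally show ?thesis by (simp add: tangle_infinity_def)
qed

lemma top_twist_zero: "iso 2 2 (top_twist r tangle_zero) tangle_zero"
  using reidemeister1_cup[of "over r" 0] unfolding tangle_zero_def
  by (intro iso_moveI[of "[(0, Cup), (0, over r)]" "[(0, Cup)]" _ "[(0, Cap)]" "[]"]) auto

lemma bottom_twist_zero: "iso 2 2 (bottom_twist r tangle_zero) tangle_zero"
  using reidemeister1_cap[of "over r" 0] unfolding tangle_zero_def
  by (intro iso_moveI[of "[(0, over r), (0, Cap)]" "[(0, Cap)]" _ "[]" "[(0, Cup)]"]) auto

text \<open>A single crossing arises both from [0] and from [\<infinity>]. For the two values of
  \<open>r\<close> this gives the axioms \<open>a Z = b' I\<close> and \<open>a' Z = b I\<close> of
  \<open>fraction_action\<close>.\<close>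

lemma right_twist_zero: "iso 2 2 (right_twist r tangle_zero) (top_twist r tangle_infinity)"
proof -
  have "iso 2 2 (right_twist r tangle_zero)
      [(1, Cup), (0, Cap), (0, Cup), (1, over (\<not> r)), (2, Cap)]"
    using right_twist_swing[of tangle_zero r] by (simp add: tangle_zero_def)
  also have "iso 2 2 \<dots> [(0, Cup), (1, over (\<not> r)), (2, Cap)]"
    using zigzag_right[of 0]
    by (intro iso_moveI[of "[(1, Cup), (0, Cap)]" "[]" _ "[]"
          "[(0, Cup), (1, over (\<not> r)), (2, Cap)]"]) auto
  also have "iso 2 2 \<dots> [(1, Cup), (0, over r), (2, Cap)]"
    using move_swing_cup[of 0 r]
    by (intro iso_moveI[of "[(1, Cup), (0, over r)]" "[(0, Cup), (1, over (\<not> r))]", THEN iso_sym,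
          of _ "[]" "[(2, Cap)]"]) auto
  also have "iso 2 2 \<dots> [(1, Cup), (2, Cap), (0, over r)]"
    using far[of 0 "over r" 0 Cap]
    by (intro iso_moveI[of "[(0, over r), (2, Cap)]" "[(2, Cap), (0, over r)]",
          of _ "[(1, Cup)]" "[]"]) auto
  also have "iso 2 2 \<dots> [(0, over r)]"
    using zigzag_left[of 1]
    by (intro iso_moveI[of "[(1, Cup), (2, Cap)]" "[]" _ "[]" "[(0, over r)]"]) auto
  finally show ?thesis by (simp add: tangle_infinity_def)
qed

lemma left_twist_zero: "iso 2 2 (left_twist r tangle_zero) (top_twist r tangle_infinity)"
proof -
  have "iso 2 2 (left_twist r tangle_zero)
      [(1, Cup), (2, Cap), (2, Cup), (1, over (\<not> r)), (0, Cap)]"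
    using left_twist_swing[of tangle_zero r] by (simp add: tangle_zero_def)
  also have "iso 2 2 \<dots> [(2, Cup), (1, over (\<not> r)), (0, Cap)]"
    using zigzag_left[of 1]
    by (intro iso_moveI[of "[(1, Cup), (2, Cap)]" "[]" _ "[]"
          "[(2, Cup), (1, over (\<not> r)), (0, Cap)]"]) auto
  also have "iso 2 2 \<dots> [(1, Cup), (2, over r), (0, Cap)]"
    using move_swing_cup[of 1 "\<not> r"]
    by (intro iso_moveI[of "[(2, Cup), (1, over (\<not> r))]" "[(1, Cup), (2, over r)]" _
          "[]" "[(0, Cap)]"]) auto
  also have "iso 2 2 \<dots> [(1, Cup), (0, Cap), (0, over r)]"
    using far[of 0 Cap 0 "over r"]
    by (intro iso_moveI[of "[(0, Cap), (0, over r)]" "[(2, over r), (0, Cap)]", THEN iso_sym,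
          of _ "[(1, Cup)]" "[]"]) auto
  also have "iso 2 2 \<dots> [(0, over r)]"
    using zigzag_right[of 0]
    by (intro iso_moveI[of "[(1, Cup), (0, Cap)]" "[]" _ "[]" "[(0, over r)]"]) auto
  finally show ?thesis by (simp add: tangle_infinity_def)
qed

section \<open>Isotopy classes of two-tangles\<close>

\<comment> \<open>Only on classes are the twists bijections that satisfy the braid relation as an
  equation, which is what the abstract locales require.\<close>
quotient_type tangle = layers / partial: "iso 2 2"
proof (rule part_equivpI)
  show "\<exists>D. iso 2 2 D D"
    using iso_refl[of 2 "[]" 2] by auto
  show "symp (iso 2 2)"
    by (rule sympI) (rule iso_sym)
  show "transp (iso 2 2)"
    by (rule transpI) (rule iso_trans)
qed

lift_definition right :: "bool \<Rightarrow> tangle \<Rightarrow> tangle" is "\<lambda>r. right_twist r"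
  by (rule right_twist_cong)

lift_definition left :: "bool \<Rightarrow> tangle \<Rightarrow> tangle" is "\<lambda>r. left_twist r"
  by (rule left_twist_cong)

lift_definition upper :: "bool \<Rightarrow> tangle \<Rightarrow> tangle" is "\<lambda>r. top_twist r"
  by (rule top_twist_cong)

lift_definition lower :: "bool \<Rightarrow> tangle \<Rightarrow> tangle" is "\<lambda>r. bottom_twist r"
  by (rule bottom_twist_cong)

lift_definition infinity_tangle :: tangle is tangle_infinity
  by (rule iso_refl) (simp add: tangle_infinity_def)

lift_definition zero_tangle :: tangle is tangle_zero
  by (rule iso_refl) (simp add: tangle_zero_def)

lemma twist_cancel:
  "right r (right (\<not> r) t) = t" "left r (left (\<not> r) t) = t"
  "upper r (upper (\<not> r) t) = t" "lower r (lower (\<not> r) t) = t"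
  by (transfer, blast intro: right_twist_cancel left_twist_cancel top_twist_cancel
      bottom_twist_cancel dest: iso_diagram(1))+

lemma twist_braid:
  "right r (upper (\<not> r) (right r t)) = upper (\<not> r) (right r (upper (\<not> r) t))"
  "left r (upper (\<not> r) (left r t)) = upper (\<not> r) (left r (upper (\<not> r) t))"
  "right r (lower (\<not> r) (right r t)) = lower (\<not> r) (right r (lower (\<not> r) t))"
  by (transfer, blast intro: right_top_braid left_top_braid right_bottom_braid
      dest: iso_diagram(1))+

lemma right_left_comm: "right r (left s t) = left s (right r t)"
  by (transfer, blast intro: right_left_commute dest: iso_diagram(1))

lemma top_bottom_comm: "upper r (lower s t) = lower s (upper r t)"
proof (transfer)
  fix r s D assume "iso 2 2 D D"
  from top_twist_cong[OF bottom_twist_cong[OF this]]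
  show "iso 2 2 (top_twist r (bottom_twist s D)) (bottom_twist s (top_twist r D))"
    by simp
qed

lemma twist_fixed:
  "right r infinity_tangle = infinity_tangle" "left r infinity_tangle = infinity_tangle"
  "upper r zero_tangle = zero_tangle" "lower r zero_tangle = zero_tangle"
  by (transfer, rule right_twist_infinity left_twist_infinity top_twist_zero bottom_twist_zero)+

lemma twist_exchange:
  "right r zero_tangle = upper r infinity_tangle" "left r zero_tangle = upper r infinity_tangle"
  by (transfer, rule right_twist_zero left_twist_zero)+

lemma bottom_infinity: "lower r infinity_tangle = upper r infinity_tangle"
proof transfer
  show "iso 2 2 (bottom_twist r tangle_infinity) (top_twist r tangle_infinity)" for r
    by (simp add: tangle_infinity_def iso_refl)
qed

text \<open>On fractions \<open>upper True\<close> is r \<mapsto> r / (1 + r), so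
  \<open>upper False\<close> takes the part of \<open>b\<close>. The braid relations likewise pair
  twists of opposite directions.\<close>

interpretation right_top: fraction_action "right True" "right False" "upper False" "upper True"
  infinity_tangle zero_tangle
  using twist_cancel[of True] twist_cancel[of False] twist_braid[of True] twist_fixed
    twist_exchange by unfold_locales simp_all

text \<open>The same action with the roles exchanged, so that \<open>orbit_coincide\<close> can also
  compare bottom twists with top twists.\<close>

interpretation top_right: braid_action "upper False" "upper True" "right True" "right False"
  using right_top.braid by unfold_locales simp_all

abbreviation orbit :: "tangle \<Rightarrow> bool" where
  "orbit \<equiv> right_top.orbit infinity_tangle"

lemma orbit_right: "orbit t \<Longrightarrow> orbit (right r t)"
  and orbit_top: "orbit t \<Longrightarrow> orbit (upper r t)"
  by (cases r; auto intro: right_top.orbit.intros)+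

lemma orbit_zero: "orbit zero_tangle"
proof -
  have "zero_tangle = right False (upper True infinity_tangle)"
    using twist_exchange(1)[of True] by (metis right_top.a_inv(2))
  then show ?thesis
    using orbit_right orbit_top right_top.orbit.base by metis
qed

text \<open>The comparison of bottom and top twists starts from [0], which both of them fix. The
  base points share an orbit because a crossing is a twist of either of them.\<close>

lemma orbit_swap: "orbit t \<Longrightarrow> top_right.orbit zero_tangle t"
proof (induction rule: right_top.orbit.induct)
  case base
  have "infinity_tangle = upper False (right True zero_tangle)"
    by (simp add: twist_exchange)
  then show ?case
    using top_right.orbit.intros by metis
qed (blast intro: top_right.orbit.intros)+

lemma left_eq_right:
  assumes "orbit t"
  shows "left r t = right r t"
proof -
  have True_eq: "left True s = right True s" if "orbit s" for s
  proof (rule right_top.orbit_coincide[OF _ _ _ _ _ _ that])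
    show "left True (left False t) = t" "left False (left True t) = t" for t
      using twist_cancel(2)[of True] twist_cancel(2)[of False] by simp_all
    show "left True (upper False (left True t)) = upper False (left True (upper False t))" for t
      using twist_braid(2)[of True] by simp
    show "right True (left True t) = left True (right True t)" for t
      by (rule right_left_comm)
    show "left True infinity_tangle = right True infinity_tangle"
      by (simp add: twist_fixed)
    \<comment> \<open>\<open>upper True\<close> of [\<infinity>] is a right twist and also a left
      twist of [0], and these two operators commute.\<close>
    show "left True (upper True infinity_tangle) = right True (upper True infinity_tangle)"
      by (metis right_left_comm twist_exchange)
  qed
  have "left False t = right False t"
    using True_eq[OF right_top.orbit.a'[OF assms]] twist_cancel(2)[of False "right False t"] by simp
  then show ?thesis using True_eq[OF assms] by (cases r) simp_all
qed

lemma bottom_eq_top: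
  assumes "orbit t"
  shows "lower r t = upper r t"
proof -
  have False_eq: "lower False s = upper False s" if "orbit s" for s
  proof (rule top_right.orbit_coincide[OF _ _ _ _ _ _ orbit_swap[OF that]])
    show "lower False (lower True t) = t" "lower True (lower False t) = t" for t
      using twist_cancel(4)[of True] twist_cancel(4)[of False] by simp_all
    show "lower False (right True (lower False t)) = right True (lower False (right True t))" for t
      using twist_braid(3)[of True] by simp
    show "upper False (lower False t) = lower False (upper False t)" for t
      by (rule top_bottom_comm)
    show "lower False zero_tangle = upper False zero_tangle"
      by (simp add: twist_fixed)
    \<comment> \<open>Likewise \<open>right False\<close> of [0] is a top twist and also a bottom
      twist of [\<infinity>].\<close>
    show "lower False (right False zero_tangle) = upper False (right False zero_tangle)"
      by (metis bottom_infinity top_bottom_comm twist_exchange(1))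
  qed
  have "lower True t = upper True t"
    using False_eq[OF right_top.orbit.b'[OF assms]] twist_cancel(4)[of True "upper True t"] by simp
  then show ?thesis using False_eq[OF assms] by (cases r) simp_all
qed

lemma abs_tangle_eq_iff: "two_tangle D \<Longrightarrow> two_tangle E \<Longrightarrow> abs_tangle D = abs_tangle E \<longleftrightarrow> isotopic D E"
  using Quotient3_rel[OF Quotient3_tangle, of D E] iso_refl
  by (auto simp: isotopic_iff_iso)

lemma abs_tangle_twist:
  assumes "two_tangle D"
  shows "abs_tangle (right_twist r D) = right r (abs_tangle D)"
    "abs_tangle (left_twist r D) = left r (abs_tangle D)"
    "abs_tangle (top_twist r D) = upper r (abs_tangle D)"
    "abs_tangle (bottom_twist r D) = lower r (abs_tangle D)"
  using iso_refl[OF assms] by (simp_all add: right.abs_eq left.abs_eq upper.abs_eq lower.abs_eq)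

text \<open>Left and bottom twists do not leave the orbit, although it is generated by right and top
  twists: on it they coincide with these.\<close>

lemma rational_orbit: "rational D \<Longrightarrow> two_tangle D \<and> orbit (abs_tangle D)"
proof (induction rule: rational.induct)
  case infinity
  then show ?case
    using right_top.orbit.base by (simp add: tangle_infinity_def infinity_tangle.abs_eq)
next
  case zero
  then show ?case
    using orbit_zero by (simp add: tangle_zero_def zero_tangle.abs_eq)
next
  case (twist_top D x)
  then obtain r where "x = over r" by (auto simp: crossing_iff_over)
  with twist_top show ?case
    by (auto simp: abs_tangle_twist diagram_append tangle_diagrams intro: orbit_top)
next
  case (twist_bottom D x)
  then obtain r where "x = over r" by (auto simp: crossing_iff_over)
  with twist_bottom show ?case
    by (auto simp: abs_tangle_twist bottom_eq_top intro: orbit_top)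
next
  case (twist_right D x)
  then obtain r where "x = over r" by (auto simp: crossing_iff_over)
  with twist_right show ?case
    by (auto simp: abs_tangle_twist two_tangle_hsum intro: orbit_right)
next
  case (twist_left D x)
  then obtain r where "x = over r" by (auto simp: crossing_iff_over)
  with twist_left show ?case
    by (auto simp: abs_tangle_twist left_eq_right two_tangle_hsum intro: orbit_right)
next
  case (isotopy D D')
  then have "iso 2 2 D D'" by (simp add: isotopic_iff_iso)
  with isotopy show ?case
    using abs_tangle_eq_iff[of D D'] iso_diagram(2) by metis
qed

lemma rational_fraction:
  assumes "rational D"
  obtains p q where "coprime p q" "abs_tangle D = right_top.pos p q"
  | p q where "coprime p q" "abs_tangle D = right_top.neg p q"
  using rational_orbit[OF assms] right_top.orbit_cases by blast

section \<open>Colourings of the horizontal levels\<close>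

text \<open>\<open>layer i p s t\<close>: the colours \<open>s\<close> and \<open>t\<close> of the strands below and above a layer \<open>(i, p)\<close>
  obey the colouring rule. \<open>trace s D ss t\<close>: \<open>s # ss\<close> colours all levels of \<open>D\<close>, from \<open>s\<close> at the
  bottom to \<open>t\<close> at the top.\<close>

fun layer :: "nat \<Rightarrow> piece \<Rightarrow> complex list \<Rightarrow> complex list \<Rightarrow> bool" where
  "layer 0 Cup s t \<longleftrightarrow> (\<exists>x. t = x # x # s)"
| "layer 0 Cap s t \<longleftrightarrow> (\<exists>x. s = x # x # t)"
| "layer 0 OverRight s t \<longleftrightarrow> (\<exists>x y r. s = x # y # r \<and> t = (2 * x - y) # x # r)"
| "layer 0 OverLeft s t \<longleftrightarrow> (\<exists>x y r. s = x # y # r \<and> t = y # (2 * y - x) # r)"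
| "layer (Suc i) p s t \<longleftrightarrow> (\<exists>x s' t'. s = x # s' \<and> t = x # t' \<and> layer i p s' t')"

fun trace :: "complex list \<Rightarrow> layers \<Rightarrow> complex list list \<Rightarrow> complex list \<Rightarrow> bool" where
  "trace s [] ss t \<longleftrightarrow> ss = [] \<and> s = t"
| "trace s ((i, p) # D) ss t \<longleftrightarrow> (\<exists>r rs. ss = r # rs \<and> layer i p s r \<and> trace r D rs t)"

definition connects :: "layers \<Rightarrow> complex list \<Rightarrow> complex list \<Rightarrow> bool" where
  "connects D s t \<longleftrightarrow> (\<exists>ss. trace s D ss t)"

text \<open>Boundary values force the colours of all inner levels. This fails in general: the colour
  of a closed circle is free.\<close>

definition determined :: "nat \<Rightarrow> layers \<Rightarrow> bool" where
  "determined m D \<longleftrightarrow>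
    (\<forall>s ss ss' t. length s = m \<longrightarrow> trace s D ss t \<longrightarrow> trace s D ss' t \<longrightarrow> ss = ss')"

lemma trace_append:
  "trace s (A @ B) ss t \<longleftrightarrow> (\<exists>r rs us. ss = rs @ us \<and> trace s A rs r \<and> trace r B us t)"
proof (induction A arbitrary: s ss)
  case (Cons l A)
  obtain i p where l: "l = (i, p)" by fastforce
  show ?case unfolding l
    by (auto simp: Cons.IH) (metis append_Cons)+
qed auto

lemma connects_append: "connects (A @ B) s t \<longleftrightarrow> (\<exists>r. connects A s r \<and> connects B r t)"
  unfolding connects_def trace_append by blast

lemma connects_Nil: "connects [] s t \<longleftrightarrow> s = t"
  by (simp add: connects_def)

lemma connects_Cons: "connects ((i, p) # D) s t \<longleftrightarrow> (\<exists>r. layer i p s r \<and> connects D r t)"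
  unfolding connects_def by auto

lemma trace_length: "trace s D ss t \<Longrightarrow> length ss = length D"
  by (induction s D ss t rule: trace.induct) auto

lemma trace_last: "trace s D ss t \<Longrightarrow> t = last (s # ss)"
  by (induction s D ss t rule: trace.induct) auto

lemma layer_length:
  "layer i p s t \<Longrightarrow> i + ins p \<le> length s \<and> length t = length s - ins p + outs p"
proof (induction i p s t rule: layer.induct)
  case (5 i p s t)
  then obtain x s' t' where "s = x # s'" "t = x # t'" and l: "layer i p s' t'"
    by auto
  moreover have "i + ins p \<le> length s' \<and> length t' = length s' - ins p + outs p"
    using 5(1) l by blast
  ultimately show ?case by (cases p) auto
qed auto

lemma trace_diagram: "trace s D ss t \<Longrightarrow> diagram (length s) D (length t)"
proof (induction s D ss t rule: trace.induct)
  case (2 s i p D ss t)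
  then obtain r rs where "layer i p s r" "trace r D rs t" and IH: "diagram (length r) D (length t)"
    by auto
  then show ?case using layer_length[of i p s r] by simp
qed simp

lemma layer_prefix:
  "layer (length u + i) p (u @ s) w \<longleftrightarrow> (\<exists>t. w = u @ t \<and> layer i p s t)"
  by (induction u arbitrary: w) auto

lemma trace_prefix:
  "trace (u @ s) (shift (length u) D) ss w \<longleftrightarrow>
    (\<exists>t rs. w = u @ t \<and> ss = map ((@) u) rs \<and> trace s D rs t)"
proof (induction D arbitrary: s ss)
  case (Cons l D)
  obtain i p where l: "l = (i, p)" by fastforce
  have "trace (u @ s) (shift (length u) (l # D)) ss w \<longleftrightarrow>
      (\<exists>r rs. ss = (u @ r) # rs \<and> layer i p s r \<and> trace (u @ r) (shift (length u) D) rs w)"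
    unfolding l shift_simps trace.simps add.commute[of i] layer_prefix by blast
  also have "\<dots> \<longleftrightarrow> (\<exists>r t rs. ss = (u @ r) # map ((@) u) rs \<and> layer i p s r \<and>
      w = u @ t \<and> trace r D rs t)"
    unfolding Cons.IH by blast
  also have "\<dots> \<longleftrightarrow> (\<exists>t rs. w = u @ t \<and> ss = map ((@) u) rs \<and> trace s (l # D) rs t)"
    unfolding l trace.simps by (metis list.simps(9))
  finally show ?case .
qed auto

lemma layer_suffix:
  "i + ins p \<le> length s \<Longrightarrow> layer i p (s @ v) w \<longleftrightarrow> (\<exists>t. w = t @ v \<and> layer i p s t)"
proof (induction i arbitrary: s w)
  case 0
  show ?case
  proof (cases p)
    case Cup
    then show ?thesis by auto
  next
    case Cap
    with 0 obtain x y r where "s = x # y # r"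
      by (auto simp: numeral_2_eq_2 Suc_le_length_iff)
    with Cap show ?thesis by auto
  next
    case OverRight
    with 0 obtain x y r where "s = x # y # r"
      by (auto simp: numeral_2_eq_2 Suc_le_length_iff)
    with OverRight show ?thesis by auto
  next
    case OverLeft
    with 0 obtain x y r where "s = x # y # r"
      by (auto simp: numeral_2_eq_2 Suc_le_length_iff)
    with OverLeft show ?thesis by auto
  qed
next
  case (Suc i)
  then obtain x s' where s: "s = x # s'" by (cases s) auto
  with Suc.prems have "i + ins p \<le> length s'" by simp
  from Suc.IH[OF this] show ?case by (auto simp: s)
qed

lemma trace_suffix:
  assumes "diagram (length s) D n"
  shows "trace (s @ v) D ss w \<longleftrightarrow>
    (\<exists>t rs. w = t @ v \<and> ss = map (\<lambda>z. z @ v) rs \<and> trace s D rs t)"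
  using assms
proof (induction D arbitrary: s ss)
  case (Cons l D)
  obtain i p where l: "l = (i, p)" by fastforce
  from Cons.prems l have i: "i + ins p \<le> length s"
    and D: "diagram (length s - ins p + outs p) D n" by auto
  have IH: "trace (r @ v) D rs w \<longleftrightarrow>
    (\<exists>t us. w = t @ v \<and> rs = map (\<lambda>z. z @ v) us \<and> trace r D us t)"
    if "layer i p s r" for r rs
    using Cons.IH[of r rs] D layer_length[OF that] by simp
  have "trace (s @ v) (l # D) ss w \<longleftrightarrow>
      (\<exists>r rs. ss = (r @ v) # rs \<and> layer i p s r \<and> trace (r @ v) D rs w)"
    unfolding l trace.simps layer_suffix[OF i] by blast
  also have "\<dots> \<longleftrightarrow> (\<exists>r t rs. ss = (r @ v) # map (\<lambda>z. z @ v) rs \<and> layer i p s r \<and>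
      w = t @ v \<and> trace r D rs t)"
    using IH by blast
  also have "\<dots> \<longleftrightarrow> (\<exists>t rs. w = t @ v \<and> ss = map (\<lambda>z. z @ v) rs \<and> trace s (l # D) rs t)"
    unfolding l trace.simps by (metis (no_types, lifting) list.simps(9))
  finally show ?case .
qed auto

lemma layer_crossing_unique:
  "layer 0 (over r) s t \<Longrightarrow> layer 0 (over r) s t' \<Longrightarrow> t = t'"
  "layer 0 (over r) s t \<Longrightarrow> layer 0 (over r) s' t \<Longrightarrow> s = s'"
  by (cases r; auto simp: over_def)+

subsection \<open>Invariance under isotopy\<close>

text \<open>Each move is brought to position 0, where it is a computation. \<open>w\<close> counts
  the strands that must be present when one side is the empty diagram, which unlike the other side
  accepts any number: 1 for a zigzag, 2 for Reidemeister II.\<close>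

lemma move_local:
  assumes "move L R" and "diagram m L n"
  obtains i w L0 R0 where "L = shift i L0" "R = shift i R0" "i + w \<le> m"
    "\<And>s t. w \<le> length s \<Longrightarrow> connects L0 s t \<longleftrightarrow> connects R0 s t"
    "\<And>k. determined k L0" "\<And>k. determined k R0"
proof -
  have two: "\<exists>x y r. s = x # y # r" if "2 \<le> length s" for s :: "complex list"
    using that by (auto simp: numeral_2_eq_2 Suc_le_length_iff)
  have one: "\<exists>x r. s = x # r" if "1 \<le> length s" for s :: "complex list"
    using that by (cases s) auto
  note defs = connects_def determined_def One_nat_def
  show thesis
    using assms(1)
  proof cases
    case (far i p k q)
    show thesis
    proof (rule that[of i "[(0, p), (outs p + k, q)]" "[(ins p + k, q), (0, p)]" 0])
      show "connects [(0, p), (outs p + k, q)] s t = connects [(ins p + k, q), (0, p)] s t" for s t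
        by (cases p) (auto simp: defs numeral_2_eq_2, blast+)
      show "determined l [(0, p), (outs p + k, q)]" "determined l [(ins p + k, q), (0, p)]" for l
        by (cases p; auto simp: defs numeral_2_eq_2)+
    qed (use assms(2) far in \<open>auto simp: add_ac\<close>)
  next
    case (zigzag_left i)
    show thesis
    proof (rule that[of i "[(0, Cup), (1, Cap)]" "[]" 1])
      show "connects [(0, Cup), (1, Cap)] s t = connects [] s t" if "1 \<le> length s" for s t
        using one[OF that] by (auto simp: defs)
    qed (use assms(2) zigzag_left in \<open>auto simp: defs\<close>)
  next
    case (zigzag_right i)
    show thesis
    proof (rule that[of i "[(1, Cup), (0, Cap)]" "[]" 1])
      show "connects [(1, Cup), (0, Cap)] s t = connects [] s t" if "1 \<le> length s" for s t
        using one[OF that] by (auto simp: defs) blast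
    qed (use assms(2) zigzag_right in \<open>auto simp: defs\<close>)
  next
    case (swing_cap_under i)
    show thesis
      by (rule that[of i "[(0, OverRight), (1, Cap)]" "[(1, OverLeft), (0, Cap)]" 0])
        (use assms(2) swing_cap_under in \<open>auto simp: defs\<close>)
  next
    case (swing_cap_over i)
    show thesis
      by (rule that[of i "[(0, OverLeft), (1, Cap)]" "[(1, OverRight), (0, Cap)]" 0])
        (use assms(2) swing_cap_over in \<open>auto simp: defs\<close>)
  next
    case (swing_cup_over i)
    show thesis
    proof (rule that[of i "[(1, Cup), (0, OverRight)]" "[(0, Cup), (1, OverLeft)]" 0])
      have "connects [(1, Cup), (0, OverRight)] s t \<longleftrightarrow>
          (\<exists>x y r. s = x # r \<and> t = (2 * x - y) # x # y # r)" for s t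
        by (auto simp: defs)
      moreover have "connects [(0, Cup), (1, OverLeft)] s t \<longleftrightarrow>
          (\<exists>x y r. s = x # r \<and> t = y # x # (2 * x - y) # r)" for s t
        by (auto simp: defs)
      \<comment> \<open>The colour of the new strand is free, and y \<mapsto> 2x - y is an
        involution, so parametrising by either end of that strand gives the same set.\<close>
      moreover have "y = 2 * x - (2 * x - y)" for x y :: complex
        by simp
      ultimately show "connects [(1, Cup), (0, OverRight)] s t = connects [(0, Cup), (1, OverLeft)] s t"
        for s t by metis
    qed (use assms(2) swing_cup_over in \<open>auto simp: defs\<close>)
  next
    case (swing_cup_under i)
    show thesis
      by (rule that[of i "[(1, Cup), (0, OverLeft)]" "[(0, Cup), (1, OverRight)]" 0])
        (use assms(2) swing_cup_under in \<open>auto simp: defs\<close>)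
  next
    case (reidemeister1_cap x i)
    then have "x = OverRight \<or> x = OverLeft" by (simp add: crossing_def)
    then show thesis
      by (intro that[of i "[(0, x), (0, Cap)]" "[(0, Cap)]" 0])
        (use assms(2) reidemeister1_cap in \<open>auto simp: defs\<close>)
  next
    case (reidemeister1_cup x i)
    then have "x = OverRight \<or> x = OverLeft" by (simp add: crossing_def)
    then show thesis
      by (intro that[of i "[(0, Cup), (0, x)]" "[(0, Cup)]" 0])
        (use assms(2) reidemeister1_cup in \<open>auto simp: defs\<close>)
  next
    case (reidemeister2_right i)
    show thesis
    proof (rule that[of i "[(0, OverRight), (0, OverLeft)]" "[]" 2])
      show "connects [(0, OverRight), (0, OverLeft)] s t = connects [] s t" if "2 \<le> length s" for s t
        using two[OF that] by (auto simp: defs)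
    qed (use assms(2) reidemeister2_right in \<open>auto simp: defs\<close>)
  next
    case (reidemeister2_left i)
    show thesis
    proof (rule that[of i "[(0, OverLeft), (0, OverRight)]" "[]" 2])
      show "connects [(0, OverLeft), (0, OverRight)] s t = connects [] s t" if "2 \<le> length s" for s t
        using two[OF that] by (auto simp: defs)
    qed (use assms(2) reidemeister2_left in \<open>auto simp: defs\<close>)
  next
    case (reidemeister3 x i)
    then have x: "x = OverRight \<or> x = OverLeft" by (simp add: crossing_def)
    let ?L = "\<lambda>x. [(0, x), (1, x), (0, x)]" and ?R = "\<lambda>x. [(1, x), (0, x), (1, x)]"
    show thesis
    proof (rule that[of i "?L x" "?R x" 0])
      have "connects (?L OverRight) s t \<longleftrightarrow> (\<exists>x y z r. s = x # y # z # r \<and>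
            t = (2 * (2 * x - y) - (2 * x - z)) # (2 * x - y) # x # r)"
          "connects (?R OverRight) s t \<longleftrightarrow> (\<exists>x y z r. s = x # y # z # r \<and>
            t = (2 * x - (2 * y - z)) # (2 * x - y) # x # r)"
          "connects (?L OverLeft) s t \<longleftrightarrow> (\<exists>x y z r. s = x # y # z # r \<and>
            t = z # (2 * z - y) # (2 * z - (2 * y - x)) # r)"
          "connects (?R OverLeft) s t \<longleftrightarrow> (\<exists>x y z r. s = x # y # z # r \<and>
            t = z # (2 * z - y) # (2 * (2 * z - y) - (2 * z - x)) # r)" for s t
        by (auto simp: defs)
      \<comment> \<open>Reidemeister III is the self-distributivity of the reflection y \<mapsto> 2x
        - y.\<close>
      moreover have "2 * (2 * x - y) - (2 * x - z) = 2 * x - (2 * y - z)" for x y z :: complex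
        by simp
      ultimately show "connects (?L x) s t = connects (?R x) s t" for s t
        using x by auto
    qed (use assms(2) reidemeister3 x in \<open>auto simp: defs\<close>)
  qed
qed

lemma connects_prefix:
  "connects (shift (length u) D) (u @ s) w \<longleftrightarrow> (\<exists>t. w = u @ t \<and> connects D s t)"
  unfolding connects_def trace_prefix by blast

lemma determined_shift:
  assumes "determined k D" and "m = i + k"
  shows "determined m (shift i D)"
  unfolding determined_def
proof (intro allI impI)
  fix s ss ss' t
  assume s: "length s = m" and tr: "trace s (shift i D) ss t" "trace s (shift i D) ss' t"
  define u v where "u = take i s" and "v = drop i s"
  have uv: "s = u @ v" "length u = i" "length v = k"
    using s assms(2) by (auto simp: u_def v_def)
  obtain rs rs' r r' where "ss = map ((@) u) rs" "trace v D rs r" "t = u @ r"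
    "ss' = map ((@) u) rs'" "trace v D rs' r'" "t = u @ r'"
    using tr unfolding uv(1) uv(2)[symmetric] trace_prefix by blast
  moreover from this have "rs = rs'"
    using assms(1) uv(3) unfolding determined_def by (metis same_append_eq)
  ultimately show "ss = ss'" by simp
qed

lemma move_invariant:
  assumes "move L R" and "diagram m L n"
  shows "length s = m \<Longrightarrow> connects L s t \<longleftrightarrow> connects R s t"
    and "determined m L" and "determined m R"
proof -
  obtain i w L0 R0 where L: "L = shift i L0" and R: "R = shift i R0" and i: "i + w \<le> m"
    and conn: "\<And>s t. w \<le> length s \<Longrightarrow> connects L0 s t \<longleftrightarrow> connects R0 s t"
    and det: "\<And>k. determined k L0" "\<And>k. determined k R0"
    by (rule move_local[OF assms]) (rule that)
  show "determined m L" "determined m R"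
    using det i unfolding L R by (auto intro!: determined_shift[where k = "m - i"])
  assume s: "length s = m"
  define u v where "u = take i s" and "v = drop i s"
  have uv: "s = u @ v" "length u = i" "w \<le> length v"
    using s i by (auto simp: u_def v_def)
  then show "connects L s t \<longleftrightarrow> connects R s t"
    unfolding L R uv(1) uv(2)[symmetric] connects_prefix conn[OF uv(3)] by simp
qed

text \<open>Two colourings with \<open>R\<close> in the middle and the same ends become, with their
  parts in \<open>R\<close> exchanged for parts in \<open>L\<close>, two colourings that must be
  equal. Hence they agreed outside \<open>R\<close> and at its ends, and then also inside, because
  \<open>R\<close> is determined.\<close>

lemma determined_replace:
  assumes det: "determined m (A @ L @ B)" and R: "determined k R"
    and A: "diagram m A k"
    and conn: "\<And>s t. length s = k \<Longrightarrow> connects R s t \<Longrightarrow> connects L s t"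
  shows "determined m (A @ R @ B)"
  unfolding determined_def
proof (intro allI impI)
  fix s ss ss' t
  assume s: "length s = m" and "trace s (A @ R @ B) ss t" and "trace s (A @ R @ B) ss' t"
  then obtain a x r y b a' x' r' y' b'
    where ss: "ss = a @ r @ b" "ss' = a' @ r' @ b'"
      and a: "trace s A a x" "trace s A a' x'"
      and r: "trace x R r y" "trace x' R r' y'"
      and b: "trace y B b t" "trace y' B b' t"
    unfolding trace_append by blast
  have len: "length x = k" "length x' = k"
    using a[THEN trace_diagram] A s diagram_strands by metis+
  obtain l l' where l: "trace x L l y" "trace x' L l' y'"
    using conn len r unfolding connects_def by metis
  have "trace s (A @ L @ B) (a @ l @ b) t" "trace s (A @ L @ B) (a' @ l' @ b') t"
    unfolding trace_append using a l b by blast+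
  with det s have "a @ l @ b = a' @ l' @ b'"
    unfolding determined_def by blast
  moreover have "length a = length a'" "length l = length l'"
    using a l trace_length by metis+
  ultimately have eq: "a = a'" "l = l'" "b = b'"
    by simp_all
  then have "x = x'" "y = y'"
    using a l trace_last by metis+
  with R r len have "r = r'"
    unfolding determined_def by blast
  with eq ss show "ss = ss'" by simp
qed

lemma iso_step_invariant:
  assumes "iso_step m n D E"
  shows "length s = m \<Longrightarrow> connects D s t \<longleftrightarrow> connects E s t"
    and "determined m D \<longleftrightarrow> determined m E"
proof -
  obtain A L R B where move: "move L R" and D: "D = A @ L @ B" and E: "E = A @ R @ B"
    and dD: "diagram m D n" and dE: "diagram m E n"
    using assms unfolding iso_step_def by blast
  define k where "k = strands m A"
  have A: "diagram m A k" and L: "diagram k L (strands k L)"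
    using dD unfolding D k_def by (simp_all add: diagram_append)
  note inv = move_invariant[OF move L]
  show "determined m D \<longleftrightarrow> determined m E"
    using determined_replace[of m A L B k R] determined_replace[of m A R B k L] A inv
    unfolding D E by blast
  assume s: "length s = m"
  have "length x = k" if "connects A s x" for x
    using that s A trace_diagram diagram_strands unfolding connects_def by metis
  then show "connects D s t \<longleftrightarrow> connects E s t"
    unfolding D E connects_append using inv(1) by blast
qed

lemma iso_invariant:
  assumes "iso m n D E"
  shows "length s = m \<Longrightarrow> connects D s t \<longleftrightarrow> connects E s t"
    and "determined m D \<longleftrightarrow> determined m E"
proof -
  from assms have "equivclp (iso_step m n) D E" by (simp add: iso_def)
  then have "(\<forall>s t. length s = m \<longrightarrow> connects D s t = connects E s t) \<and>
      (determined m D \<longleftrightarrow> determined m E)"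
  proof (induction rule: equivclp_induct)
    case (step E F)
    then show ?case using iso_step_invariant[of m n E F] iso_step_invariant[of m n F E] by metis
  qed simp
  then show "length s = m \<Longrightarrow> connects D s t \<longleftrightarrow> connects E s t"
    and "determined m D \<longleftrightarrow> determined m E" by blast+
qed

section \<open>The boundary values of a colouring determine the fraction\<close>

lift_definition boundary :: "tangle \<Rightarrow> (complex list \<times> complex list) set" is
  "\<lambda>D. {(s, t). length s = 2 \<and> connects D s t}"
  using iso_invariant(1) by blast

lift_definition rigid :: "tangle \<Rightarrow> bool" is "determined 2"
  by (rule iso_invariant(2))

lemma boundary_length:
  assumes "(s, t) \<in> boundary T"
  obtains x0 x1 y0 y1 where "s = [x0, x1]" "t = [y0, y1]"
proof -
  have "length s = 2 \<and> length t = 2"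
    using assms
  proof transfer
    fix s t D assume "iso 2 2 D D" and "(s, t) \<in> {(s, t). length s = 2 \<and> connects D s t}"
    then obtain ss where s: "length s = 2" and "trace s D ss t" and D: "two_tangle D"
      using iso_diagram(1) unfolding connects_def by blast
    from this(2)[THEN trace_diagram, THEN diagram_strands] D[THEN diagram_strands] s
    show "length s = 2 \<and> length t = 2" by simp
  qed
  then show thesis
    using that by (auto simp: numeral_2_eq_2 length_Suc_conv)
qed

lemma boundary_upper:
  "(s, t) \<in> boundary (upper r T) \<longleftrightarrow> (\<exists>u. (s, u) \<in> boundary T \<and> layer 0 (over r) u t)"
  by transfer (auto simp: connects_append connects_Cons connects_Nil)

lemma trace_top_twist:
  "trace s (top_twist r D) ss t \<longleftrightarrow> (\<exists>u us. ss = us @ [t] \<and> trace s D us u \<and> layer 0 (over r) u t)"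
  by (auto simp: trace_append)

lemma rigid_upper: "rigid T \<Longrightarrow> rigid (upper r T)"
proof (transfer, unfold determined_def trace_top_twist, intro allI impI)
  fix r D s ss ss' t
  assume det: "\<forall>s ss ss' t. length s = 2 \<longrightarrow> trace s D ss t \<longrightarrow> trace s D ss' t \<longrightarrow> ss = ss'"
    and s: "length s = (2 :: nat)"
    and "\<exists>u us. ss = us @ [t] \<and> trace s D us u \<and> layer 0 (over r) u t"
    and "\<exists>u us. ss' = us @ [t] \<and> trace s D us u \<and> layer 0 (over r) u t"
  then obtain u us u' us' where ss: "ss = us @ [t]" "ss' = us' @ [t]"
    and us: "trace s D us u" "trace s D us' u'"
    and "layer 0 (over r) u t" "layer 0 (over r) u' t"
    by blast
  then have "u = u'" using layer_crossing_unique(2) by blast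
  with det s us have "us = us'" by blast
  with ss show "ss = ss'" by simp
qed

text \<open>Every level is listed since rigidity concerns the whole colouring. \<open>y\<close> and
  \<open>w\<close> colour the strands joining \<open>D\<close> to the crossing; beside
  \<open>D\<close> the strands coloured \<open>y\<close> and \<open>x1\<close> pass
  unchanged.\<close>

lemma trace_right_twist:
  assumes "two_tangle D"
  shows "trace [x0, x1] (right_twist r D) ss t \<longleftrightarrow> (\<exists>y t0 w t1 us. t = [t0, t1] \<and>
    trace [x0, y] D us [t0, w] \<and> layer 0 (over r) [y, x1] [w, t1] \<and>
    ss = [x0, y, y, x1] # map (\<lambda>z. z @ [y, x1]) us @ [[t0, w, w, t1], [t0, t1]])"
    (is "?l \<longleftrightarrow> ?r")
proof -
  let ?E = "[(2, over r), (1, Cap)]"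
  have D: "diagram (length [x0, y]) D 2" for y using assms by (simp add: numeral_2_eq_2)
  have pair: "\<exists>t0 w. u = [t0, w]" if tr: "trace [x0, y] D us u" for y us u
  proof -
    have "length u = 2"
      using trace_diagram[OF tr, THEN diagram_strands] D[of y, THEN diagram_strands] by simp
    then show ?thesis by (auto simp: numeral_2_eq_2 length_Suc_conv)
  qed
  have E: "trace [t0, w', y, x1] ?E vs t \<longleftrightarrow>
      (\<exists>t1. layer 0 (over r) [y, x1] [w', t1] \<and> t = [t0, t1] \<and> vs = [[t0, w', w', t1], [t0, t1]])"
    for t0 w' y vs
    by (cases r) (auto simp: over_def numeral_2_eq_2 One_nat_def)
  have cup: "?l \<longleftrightarrow> (\<exists>y rs. ss = [x0, y, y, x1] # rs \<and> trace ([x0, y] @ [y, x1]) (D @ ?E) rs t)"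
    by (auto simp: hsum_eq One_nat_def)
  show ?thesis
  proof
    assume ?l
    then obtain y rs where ss: "ss = [x0, y, y, x1] # rs"
      and "trace ([x0, y] @ [y, x1]) (D @ ?E) rs t"
      unfolding cup by blast
    then obtain us u vs where rs: "rs = map (\<lambda>z. z @ [y, x1]) us @ vs"
      and us: "trace [x0, y] D us u" and vs: "trace (u @ [y, x1]) ?E vs t"
      unfolding trace_append[of _ D] trace_suffix[OF D] by blast
    from pair[OF us] obtain t0 w where u: "u = [t0, w]" by blast
    from vs obtain t1 where "layer 0 (over r) [y, x1] [w, t1]" "t = [t0, t1]"
      "vs = [[t0, w, w, t1], [t0, t1]]"
      unfolding u append.simps E by blast
    with us show ?r unfolding ss rs u by blast
  next
    assume ?r
    then obtain y t0 w t1 us where t: "t = [t0, t1]" and us: "trace [x0, y] D us [t0, w]"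
      and cross: "layer 0 (over r) [y, x1] [w, t1]"
      and ss: "ss = [x0, y, y, x1] # map (\<lambda>z. z @ [y, x1]) us @ [[t0, w, w, t1], [t0, t1]]"
      by blast
    from us have "trace ([x0, y] @ [y, x1]) D (map (\<lambda>z. z @ [y, x1]) us) ([t0, w] @ [y, x1])"
      unfolding trace_suffix[OF D] by blast
    moreover have "trace ([t0, w] @ [y, x1]) ?E [[t0, w, w, t1], [t0, t1]] t"
      unfolding append.simps E using cross t by blast
    ultimately have "trace ([x0, y] @ [y, x1]) (D @ ?E)
        (map (\<lambda>z. z @ [y, x1]) us @ [[t0, w, w, t1], [t0, t1]]) t"
      unfolding trace_append[of _ D] by blast
    with ss show ?l unfolding cup by blast
  qed
qed

lemma boundary_right:
  "([x0, x1], [t0, t1]) \<in> boundary (right r T) \<longleftrightarrow>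
    (\<exists>y w. ([x0, y], [t0, w]) \<in> boundary T \<and> layer 0 (over r) [y, x1] [w, t1])"
proof transfer
  fix x0 x1 t0 t1 r T assume "iso 2 2 T T"
  then have T: "two_tangle T" by (rule iso_diagram)
  show "([x0, x1], [t0, t1]) \<in> {(s, t). length s = 2 \<and> connects (right_twist r T) s t} \<longleftrightarrow>
     (\<exists>y w. ([x0, y], [t0, w]) \<in> {(s, t). length s = 2 \<and> connects T s t} \<and>
        layer 0 (over r) [y, x1] [w, t1])"
    by (simp add: connects_def trace_right_twist[OF T])
qed

text \<open>Seen sideways a crossing is still invertible, the right ends forcing the left ones; so a
  right twist adds no freedom to the colouring.\<close>

lemma layer_crossing_right:
  assumes "layer 0 (over r) [y, x] [w, t]" "layer 0 (over r) [y', x] [w', t]"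
  shows "y = y' \<and> w = w'"
  using assms by (cases r) (auto simp: over_def)

lemma rigid_right: "rigid T \<Longrightarrow> rigid (right r T)"
proof transfer
  fix r D assume "iso 2 2 D D" and det: "determined 2 D"
  then have D: "two_tangle D" by (simp add: iso_diagram)
  show "determined 2 (right_twist r D)"
    unfolding determined_def
  proof (intro allI impI)
    fix s ss ss' t
    assume "length s = (2 :: nat)" and tr: "trace s (right_twist r D) ss t"
      "trace s (right_twist r D) ss' t"
    then obtain x0 x1 where s: "s = [x0, x1]"
      by (auto simp: numeral_2_eq_2 length_Suc_conv)
    obtain y t0 w t1 us y' w' us' where t: "t = [t0, t1]"
      and us: "trace [x0, y] D us [t0, w]" "trace [x0, y'] D us' [t0, w']"
      and cross: "layer 0 (over r) [y, x1] [w, t1]" "layer 0 (over r) [y', x1] [w', t1]"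
      and ss: "ss = [x0, y, y, x1] # map (\<lambda>z. z @ [y, x1]) us @ [[t0, w, w, t1], [t0, t1]]"
        "ss' = [x0, y', y', x1] # map (\<lambda>z. z @ [y', x1]) us' @ [[t0, w', w', t1], [t0, t1]]"
      using tr unfolding s trace_right_twist[OF D] by auto
    from layer_crossing_right[OF cross] have eq: "y = y'" "w = w'" by simp_all
    moreover have "length [x0, y] = 2" by simp
    ultimately have "us = us'"
      using us det unfolding determined_def by blast
    with eq ss show "ss = ss'" by simp
  qed
qed

lemma rigid_base: "rigid infinity_tangle" "rigid zero_tangle"
  by (transfer, auto simp: determined_def tangle_infinity_def tangle_zero_def)+

lemma rigid_orbit: "orbit T \<Longrightarrow> rigid T"
  by (induction rule: right_top.orbit.induct) (simp_all add: rigid_base rigid_right rigid_upper)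

text \<open>\<open>slope p q\<close> is the set of boundary values of the colourings of a tangle of fraction \<open>p / q\<close>.\<close>

definition slope :: "complex \<Rightarrow> complex \<Rightarrow> (complex list \<times> complex list) set" where
  "slope p q = {(s, t). \<exists>x0 x1 y0 y1. s = [x0, x1] \<and> t = [y0, y1] \<and>
     x0 + y1 = x1 + y0 \<and> q * (y0 - y1) = p * (y1 - x1)}"

lemma slope_iff: "([x0, x1], [y0, y1]) \<in> slope p q \<longleftrightarrow>
    x0 + y1 = x1 + y0 \<and> q * (y0 - y1) = p * (y1 - x1)"
  by (simp add: slope_def)

lemma boundary_eq_slopeI:
  assumes "\<And>x0 x1 y0 y1. ([x0, x1], [y0, y1]) \<in> boundary T \<longleftrightarrow> ([x0, x1], [y0, y1]) \<in> slope p q"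
  shows "boundary T = slope p q"
proof (intro set_eqI)
  fix z :: "complex list \<times> complex list"
  obtain s t where z: "z = (s, t)" by fastforce
  show "z \<in> boundary T \<longleftrightarrow> z \<in> slope p q"
  proof
    assume "z \<in> boundary T"
    then show "z \<in> slope p q"
      using assms unfolding z by (metis boundary_length)
  next
    assume "z \<in> slope p q"
    then show "z \<in> boundary T"
      using assms unfolding z by (auto simp: slope_def)
  qed
qed

text \<open>With h = y0 - y1 and v = y1 - x1 the second equation of \<open>slope\<close> is q h = p
  v. Passing to the inner ends of a right twist keeps v and replaces h by h - v or h + v, which is a
  Euclidean step on p.\<close>

lemma slope_right:
  assumes "boundary T = slope p q"
  shows "boundary (right True T) = slope (p + q) q" "boundary (right False T) = slope (p - q) q"
proof -
  have "([x0, x1], [y0, y1]) \<in> boundary (right True T) \<longleftrightarrow>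
      ([x0, y1], [y0, 2 * y1 - x1]) \<in> slope p q" for x0 x1 y0 y1
    unfolding boundary_right assms by (auto simp: over_def)
  then show "boundary (right True T) = slope (p + q) q"
    by (intro boundary_eq_slopeI) (auto simp: slope_iff algebra_simps)
  have "([x0, x1], [y0, y1]) \<in> boundary (right False T) \<longleftrightarrow>
      ([x0, 2 * x1 - y1], [y0, x1]) \<in> slope p q" for x0 x1 y0 y1
  proof -
    have "layer 0 (over False) [y, x1] [w, y1] \<longleftrightarrow> y = 2 * x1 - y1 \<and> w = x1" for y w
      by (auto simp: over_def)
    then show ?thesis unfolding boundary_right assms by simp
  qed
  then show "boundary (right False T) = slope (p - q) q"
    by (intro boundary_eq_slopeI) (auto simp: slope_iff algebra_simps)
qed

text \<open>In the same coordinates a top twist keeps h = y0 - y1 and shears v = y1 - x1, a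
  Euclidean step on q.\<close>

lemma slope_upper:
  assumes "boundary T = slope p q"
  shows "boundary (upper True T) = slope p (q + p)" "boundary (upper False T) = slope p (q - p)"
proof -
  have "([x0, x1], [y0, y1]) \<in> boundary (upper True T) \<longleftrightarrow>
      ([x0, x1], [y1, 2 * y1 - y0]) \<in> slope p q" for x0 x1 y0 y1
  proof -
    have "layer 0 (over True) u [y0, y1] \<longleftrightarrow> u = [y1, 2 * y1 - y0]" for u
      by (auto simp: over_def)
    then show ?thesis unfolding boundary_upper assms by simp
  qed
  then show "boundary (upper True T) = slope p (q + p)"
    by (intro boundary_eq_slopeI) (auto simp: slope_iff algebra_simps)
  have "([x0, x1], [y0, y1]) \<in> boundary (upper False T) \<longleftrightarrow>
      ([x0, x1], [2 * y0 - y1, y0]) \<in> slope p q" for x0 x1 y0 y1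
  proof -
    have "layer 0 (over False) u [y0, y1] \<longleftrightarrow> u = [2 * y0 - y1, y0]" for u
      by (auto simp: over_def)
    then show ?thesis unfolding boundary_upper assms by simp
  qed
  then show "boundary (upper False T) = slope p (q - p)"
    by (intro boundary_eq_slopeI) (auto simp: slope_iff algebra_simps)
qed

lemma slope_infinity: "p \<noteq> 0 \<Longrightarrow> boundary infinity_tangle = slope p 0"
proof (rule boundary_eq_slopeI)
  fix x0 x1 y0 y1 :: complex
  assume "p \<noteq> 0"
  moreover have "([x0, x1], [y0, y1]) \<in> boundary infinity_tangle \<longleftrightarrow> x0 = y0 \<and> x1 = y1"
    by transfer (simp add: tangle_infinity_def connects_Nil)
  ultimately show "([x0, x1], [y0, y1]) \<in> boundary infinity_tangle \<longleftrightarrow>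
      ([x0, x1], [y0, y1]) \<in> slope p 0"
    by (auto simp: slope_iff)
qed

lemma slope_zero: "q \<noteq> 0 \<Longrightarrow> boundary zero_tangle = slope 0 q"
proof (rule boundary_eq_slopeI)
  fix x0 x1 y0 y1 :: complex
  assume "q \<noteq> 0"
  moreover have "([x0, x1], [y0, y1]) \<in> boundary zero_tangle \<longleftrightarrow> x0 = x1 \<and> y0 = y1"
    by transfer (auto simp: tangle_zero_def connects_Cons connects_Nil)
  ultimately show "([x0, x1], [y0, y1]) \<in> boundary zero_tangle \<longleftrightarrow>
      ([x0, x1], [y0, y1]) \<in> slope 0 q"
    by (auto simp: slope_iff)
qed

lemma boundary_pos_neg:
  "0 < p + q \<Longrightarrow> boundary (right_top.pos p q) = slope (of_nat p) (of_nat q) \<and>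
    boundary (right_top.neg p q) = slope (- of_nat p) (of_nat q)"
proof (induction rule: euclid_induct)
  case (zero q)
  then show ?case by (simp add: slope_zero)
next
  case (infinity p)
  then show ?case by (simp add: slope_infinity)
next
  case (add_left p q)
  then show ?case
    using slope_right[of "right_top.pos p q"] slope_right[of "right_top.neg p q"]
    by (simp add: right_top.pos_add_left right_top.neg_add_left)
next
  case (add_right p q)
  then show ?case
    using slope_upper[of "right_top.pos p q"] slope_upper[of "right_top.neg p q"]
    by (simp add: right_top.pos_add_right right_top.neg_add_right add.commute)
qed

lemma slope_eq_imp_proportional:
  assumes "slope p q = slope p' q'"
  shows "p * q' = p' * q"
proof -
  \<comment> \<open>A point with y0 - y1 = p and y1 - x1 = q; for it the second equation of the
    other plane reads q' p = p' q.\<close>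
  have "([p - q, - q], [p, 0]) \<in> slope p q"
    by (simp add: slope_iff)
  then have "([p - q, - q], [p, 0]) \<in> slope p' q'"
    using assms(1) by simp
  then show ?thesis by (simp add: slope_iff mult.commute)
qed

lemma rational_boundary_eq_imp_isotopic:
  assumes "rational D" "rational E" and eq: "boundary (abs_tangle D) = boundary (abs_tangle E)"
  shows "isotopic D E"
proof -
  have pos_coprime: "0 < p + q" if "coprime p q" for p q :: nat
    using that by (cases "p = 0") auto
  have same: "p = p' \<and> q = q'" if "coprime p q" "coprime p' q'"
    "slope (of_nat p) (of_nat q) = slope (of_nat p') (of_nat q')
      \<or> slope (- of_nat p) (of_nat q) = slope (- of_nat p') (of_nat q')" for p q p' q' :: nat
  proof -
    from that(3) have "of_nat (p * q') = (of_nat (p' * q) :: complex)"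
      by (auto dest!: slope_eq_imp_proportional)
    then have "p * q' = p' * q" by (simp only: of_nat_eq_iff)
    then show ?thesis using coprime_crossproduct_nat that(1,2) by blast
  qed
  \<comment> \<open>Fractions of opposite sign agree only at 0 and \<infinity>, since p q' + p' q =
    0 in the natural numbers kills both products; there \<open>pos\<close> and \<open>neg\<close>
    have the same value.\<close>
  have opposite: "right_top.pos p q = right_top.neg p' q'" if "coprime p q" "coprime p' q'"
    "slope (of_nat p) (of_nat q) = slope (- of_nat p') (of_nat q')" for p q p' q' :: nat
  proof -
    from slope_eq_imp_proportional[OF that(3)]
    have "of_nat (p * q' + p' * q) = (0 :: complex)"
      by (simp add: eq_neg_iff_add_eq_0)
    then have "p * q' = 0" "p' * q = 0"
      by (simp_all only: of_nat_eq_0_iff add_is_0)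
    with that(1,2) have "p = 0 \<and> p' = 0 \<or> q = 0 \<and> q' = 0" by auto
    then show ?thesis using pos_coprime that(1,2) by fastforce
  qed
  have slopes: "boundary (right_top.pos p q) = slope (of_nat p) (of_nat q)"
    "boundary (right_top.neg p q) = slope (- of_nat p) (of_nat q)" if "coprime p q" for p q
    using boundary_pos_neg pos_coprime that by simp_all
  obtain p q where pq: "coprime p q"
    and D: "abs_tangle D = right_top.pos p q \<or> abs_tangle D = right_top.neg p q"
    using rational_fraction[OF assms(1)] by metis
  obtain p' q' where pq': "coprime p' q'"
    and E: "abs_tangle E = right_top.pos p' q' \<or> abs_tangle E = right_top.neg p' q'"
    using rational_fraction[OF assms(2)] by metis
  have "abs_tangle D = abs_tangle E"
    using D E eq slopes[OF pq] slopes[OF pq'] same[OF pq pq'] opposite[OF pq pq']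
      opposite[OF pq' pq] by metis
  moreover have "two_tangle D" "two_tangle E"
    using assms rational_orbit by blast+
  ultimately show ?thesis by (simp add: abs_tangle_eq_iff)
qed

section \<open>Colourings of the arcs\<close>

text \<open>The interface between lists of colours and arcs: read by positions, the clauses of
  \<open>layer\<close> are the rules of \<open>joined\<close> together with the two crossing
  equations of \<open>colorings\<close>.\<close>

lemma layer_iff_nth:
  "layer i p s t \<longleftrightarrow> i + ins p \<le> length s \<and> length t = length s - ins p + outs p \<and>
    (\<forall>j<i. t ! j = s ! j) \<and>
    (\<forall>j. i + ins p + j < length s \<longrightarrow> t ! (i + outs p + j) = s ! (i + ins p + j)) \<and>
    (p = Cup \<longrightarrow> t ! i = t ! Suc i) \<and> (p = Cap \<longrightarrow> s ! i = s ! Suc i) \<and>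
    (p = OverRight \<longrightarrow> t ! Suc i = s ! i \<and> 2 * s ! i = s ! Suc i + t ! i) \<and>
    (p = OverLeft \<longrightarrow> t ! i = s ! Suc i \<and> 2 * s ! Suc i = s ! i + t ! Suc i)"
proof (induction i arbitrary: s t)
  case 0
  have shape: "\<exists>x y r. xs = x # y # r" if "2 \<le> length xs" for xs :: "complex list"
    using that by (auto simp: numeral_2_eq_2 Suc_le_length_iff)
  have eqI: "xs = ys" if "length xs = length ys" "\<And>j. j < length ys \<Longrightarrow> xs ! j = ys ! j"
    for xs ys :: "complex list" using that by (intro nth_equalityI) auto
  show ?case
  proof (cases p)
    case Cup
    show ?thesis
    proof (cases "2 \<le> length t")
      case True
      with shape obtain x y r where t: "t = x # y # r" by blast
      have "r = s \<longleftrightarrow> length r = length s \<and> (\<forall>j<length s. r ! j = s ! j)"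
        using eqI by auto
      then show ?thesis unfolding t using Cup by auto
    qed (use Cup in auto)
  next
    case Cap
    show ?thesis
    proof (cases "2 \<le> length s")
      case True
      with shape obtain x y r where s: "s = x # y # r" by blast
      have "r = t \<longleftrightarrow> length t = length r \<and> (\<forall>j<length r. t ! j = r ! j)"
        using eqI[of t r] by auto
      then show ?thesis unfolding s using Cap by auto
    qed (use Cap in auto)
  next
    case OverRight
    show ?thesis
    proof (cases "2 \<le> length s \<and> 2 \<le> length t")
      case True
      with shape obtain x y r z w r' where st: "s = x # y # r" "t = z # w # r'" by metis
      have "r' = r \<longleftrightarrow> length r' = length r \<and> (\<forall>j<length r. r' ! j = r ! j)"
        using eqI[of r' r] by auto
      moreover have "z = 2 * x - y \<longleftrightarrow> 2 * x = y + z"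
        by (auto simp: algebra_simps)
      ultimately show ?thesis unfolding st using OverRight by auto
    qed (use OverRight in auto)
  next
    case OverLeft
    show ?thesis
    proof (cases "2 \<le> length s \<and> 2 \<le> length t")
      case True
      with shape obtain x y r z w r' where st: "s = x # y # r" "t = z # w # r'" by metis
      have "r' = r \<longleftrightarrow> length r' = length r \<and> (\<forall>j<length r. r' ! j = r ! j)"
        using eqI[of r' r] by auto
      moreover have "w = 2 * y - x \<longleftrightarrow> 2 * y = x + w"
        by (auto simp: algebra_simps)
      ultimately show ?thesis unfolding st using OverLeft by auto
    qed (use OverLeft in auto)
  qed
next
  case (Suc i)
  show ?case
  proof (cases "\<exists>x s' y t'. s = x # s' \<and> t = y # t'")
    case True
    then obtain x s' y t' where st: "s = x # s'" "t = y # t'" by blast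
    have len: "Suc i + ins p \<le> length s \<and> length t = length s - ins p + outs p \<and> R \<longleftrightarrow>
        i + ins p \<le> length s' \<and> length t' = length s' - ins p + outs p \<and> R" for R
      by (cases p) (auto simp: st)
    have prefix: "(\<forall>j<Suc i. t ! j = s ! j) \<longleftrightarrow> y = x \<and> (\<forall>j<i. t' ! j = s' ! j)"
      by (simp add: st All_less_Suc2)
    have suffix: "Suc i + ins p + j < length s \<longleftrightarrow> i + ins p + j < length s'"
      "t ! (Suc i + outs p + j) = t' ! (i + outs p + j)"
      "s ! (Suc i + ins p + j) = s' ! (i + ins p + j)" for j
      by (simp_all add: st)
    have "layer (Suc i) p s t \<longleftrightarrow> y = x \<and> layer i p s' t'"
      by (auto simp: st)
    also have "\<dots> \<longleftrightarrow> Suc i + ins p \<le> length s \<and> length t = length s - ins p + outs p \<and>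
        (\<forall>j<Suc i. t ! j = s ! j) \<and>
        (\<forall>j. Suc i + ins p + j < length s \<longrightarrow> t ! (Suc i + outs p + j) = s ! (Suc i + ins p + j)) \<and>
        (p = Cup \<longrightarrow> t ! Suc i = t ! Suc (Suc i)) \<and> (p = Cap \<longrightarrow> s ! Suc i = s ! Suc (Suc i)) \<and>
        (p = OverRight \<longrightarrow> t ! Suc (Suc i) = s ! Suc i \<and> 2 * s ! Suc i = s ! Suc (Suc i) + t ! Suc i) \<and>
        (p = OverLeft \<longrightarrow> t ! Suc i = s ! Suc (Suc i) \<and>
          2 * s ! Suc (Suc i) = s ! Suc i + t ! Suc (Suc i))"
      unfolding len prefix suffix Suc.IH[of s' t'] by (simp only: st nth_Cons_Suc conj_ac)
    finally show ?thesis .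
  next
    case False
    then show ?thesis by (cases s; cases t; auto)
  qed
qed

declare One_nat_def [simp] add_2_eq_Suc [simp] add_2_eq_Suc' [simp]

lemma trace_iff_nth:
  "trace s D ss t \<longleftrightarrow> length ss = length D \<and> last (s # ss) = t \<and>
    (\<forall>k<length D. layer (fst (D ! k)) (snd (D ! k)) ((s # ss) ! k) (ss ! k))"
proof (induction s D ss t rule: trace.induct)
  case (1 s ss t)
  then show ?case by auto
next
  case (2 s i p D ss t)
  show ?case
  proof (cases ss)
    case (Cons r rs)
    then show ?thesis using 2[of r rs] by (auto simp: All_less_Suc2)
  qed simp
qed

lemma strands_take_Suc:
  "k < length D \<Longrightarrow> D ! k = (i, p) \<Longrightarrow>
    strands m (take (Suc k) D) = strands m (take k D) - ins p + outs p"
  by (simp add: take_Suc_conv_app_nth strands_append)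

lemma diagram_nth:
  "diagram m D n \<Longrightarrow> k < length D \<Longrightarrow> D ! k = (i, p) \<Longrightarrow> i + ins p \<le> strands m (take k D)"
proof (induction D arbitrary: m k)
  case (Cons l D)
  then show ?case by (cases l; cases k) auto
qed simp

lemma trace_level_length:
  assumes "trace s D ss t" and "length s = 2" and "k \<le> length D"
  shows "length ((s # ss) ! k) = strands 2 (take k D)"
  using assms(3)
proof (induction k)
  case 0
  then show ?case using assms by simp
next
  case (Suc k)
  obtain i p where D: "D ! k = (i, p)" by fastforce
  have "layer i p ((s # ss) ! k) (ss ! k)"
    using assms(1) Suc.prems D unfolding trace_iff_nth by (metis Suc_le_eq fst_conv snd_conv)
  then show ?case
    using Suc D strands_take_Suc[of k D i p 2] by (auto dest: layer_length)
qed

lemma arc_eqI: "equivclp (joined D) x y \<Longrightarrow> arc D x = arc D y"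
  unfolding arc_def by (auto intro: equivclp_trans equivclp_sym)

lemma arc_joined: "joined D x y \<Longrightarrow> arc D y = arc D x"
  by (rule arc_eqI[symmetric]) (rule r_into_equivclp)

definition level :: "layers \<Rightarrow> ((nat \<times> nat) set \<Rightarrow> complex) \<Rightarrow> nat \<Rightarrow> complex list" where
  "level D c k = map (\<lambda>j. c (arc D (k, j))) [0..<strands 2 (take k D)]"

lemma length_level [simp]: "length (level D c k) = strands 2 (take k D)"
  by (simp add: level_def)

lemma nth_level: "j < strands 2 (take k D) \<Longrightarrow> level D c k ! j = c (arc D (k, j))"
  by (simp add: level_def)

lemma coloring_trace:
  assumes D: "two_tangle D" and c: "c \<in> colorings D"
  shows "trace (level D c 0) D (map (\<lambda>k. level D c (Suc k)) [0..<length D]) (level D c (length D))"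
proof -
  let ?ss = "map (\<lambda>k. level D c (Suc k)) [0..<length D]"
  have nth: "(level D c 0 # ?ss) ! k = level D c k" if "k \<le> length D" for k
    using that by (cases k) auto
  have "layer (fst (D ! k)) (snd (D ! k)) (level D c k) (level D c (Suc k))" if k: "k < length D" for k
  proof -
    obtain i p where Dk: "D ! k = (i, p)" by fastforce
    note i = diagram_nth[OF D k Dk] and S = strands_take_Suc[OF k Dk, of 2]
    have "layer i p (level D c k) (level D c (Suc k))"
      unfolding layer_iff_nth
    proof (intro conjI allI impI)
      show "i + ins p \<le> length (level D c k)"
        using i by simp
      show "length (level D c (Suc k)) = length (level D c k) - ins p + outs p"
        using S by simp
      show "level D c (Suc k) ! j = level D c k ! j" if "j < i" for j
        using that i S arc_joined[OF joined.left[OF k Dk that]] by (simp add: nth_level)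
      show "level D c (Suc k) ! (i + outs p + j) = level D c k ! (i + ins p + j)"
        if "i + ins p + j < length (level D c k)" for j
        using that i S arc_joined[OF joined.right[OF k Dk, of j]] by (simp add: nth_level)
      show "level D c (Suc k) ! i = level D c (Suc k) ! Suc i" if "p = Cup"
        using that i S arc_joined[OF joined.cup[OF k, of i]] Dk by (simp add: nth_level)
      show "level D c k ! i = level D c k ! Suc i" if "p = Cap"
        using that i S arc_joined[OF joined.cap[OF k, of i]] Dk by (simp add: nth_level)
      show "level D c (Suc k) ! Suc i = level D c k ! i" if "p = OverRight"
        using that i S arc_joined[OF joined.over_right[OF k, of i]] Dk by (simp add: nth_level)
      show "2 * level D c k ! i = level D c k ! Suc i + level D c (Suc k) ! i" if "p = OverRight"
        using that i S c k Dk by (simp add: nth_level colorings_def)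
      show "level D c (Suc k) ! i = level D c k ! Suc i" if "p = OverLeft"
        using that i S arc_joined[OF joined.over_left[OF k, of i]] Dk by (simp add: nth_level)
      show "2 * level D c k ! Suc i = level D c k ! i + level D c (Suc k) ! Suc i" if "p = OverLeft"
        using that i S c k Dk by (simp add: nth_level colorings_def)
    qed
    then show ?thesis by (simp add: Dk)
  qed
  then show ?thesis
    unfolding trace_iff_nth using nth by (auto simp: last_conv_nth)
qed

text \<open>Colours of the levels agree on points related by \<open>joined\<close>, hence descend to
  its equivalence classes, the arcs.\<close>

lemma trace_coloring:
  assumes D: "two_tangle D" and tr: "trace s D ss t" and s: "length s = 2"
  obtains c where "c \<in> colorings D"
    "\<And>k. k \<le> length D \<Longrightarrow> level D c k = (s # ss) ! k"
proof -
  define val where "val = (\<lambda>(k, j). (s # ss) ! k ! j)"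
  note len = trace_level_length[OF tr s]
  have layer: "layer i p ((s # ss) ! k) ((s # ss) ! Suc k)" if "k < length D" "D ! k = (i, p)" for k i p
  proof -
    have "layer (fst (D ! k)) (snd (D ! k)) ((s # ss) ! k) (ss ! k)"
      using tr that(1) unfolding trace_iff_nth by blast
    then show ?thesis using that(2) by simp
  qed
  have joined: "val x = val y" if "joined D x y" for x y
    using that
  proof cases
    case (left k i p j)
    then show ?thesis using layer[of k i p] by (simp add: val_def layer_iff_nth)
  next
    case (right k i p j)
    then show ?thesis using layer[of k i p] len[of k] by (simp add: val_def layer_iff_nth)
  next
    case (cup k i)
    then show ?thesis using layer[of k i Cup] by (simp add: val_def layer_iff_nth)
  next
    case (cap k i)
    then show ?thesis using layer[of k i Cap] by (simp add: val_def layer_iff_nth)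
  next
    case (over_right k i)
    then show ?thesis using layer[of k i OverRight] by (simp add: val_def layer_iff_nth)
  next
    case (over_left k i)
    then show ?thesis using layer[of k i OverLeft] by (simp add: val_def layer_iff_nth)
  qed
  have equiv: "val x = val y" if "equivclp (joined D) x y" for x y
    using that by (induction rule: equivclp_induct) (auto dest: joined)
  \<comment> \<open>Any point of the arc may represent it, as \<open>val\<close> is constant there;
    outside \<open>arcs D\<close> the value must be 0 for \<open>c\<close> to lie in
    \<open>colorings D\<close>.\<close>
  define c where "c = (\<lambda>a. if a \<in> arcs D then val (SOME x. x \<in> points D \<and> arc D x = a) else 0)"
  have c_arc: "c (arc D x) = val x" if x: "x \<in> points D" for x
  proof -
    define y where "y = (SOME y. y \<in> points D \<and> arc D y = arc D x)"
    have y: "y \<in> points D \<and> arc D y = arc D x"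
      unfolding y_def by (rule someI[of _ x]) (use x in simp)
    from y[THEN conjunct1] have "y \<in> arc D y" by (simp add: arc_def)
    with y have "y \<in> arc D x" by simp
    then have "equivclp (joined D) x y" unfolding arc_def by blast
    then have "val x = val y" by (rule equiv)
    moreover have "arc D x \<in> arcs D" unfolding arcs_def using x by (rule imageI)
    ultimately show ?thesis by (simp add: c_def y_def)
  qed
  have points: "(k, j) \<in> points D \<longleftrightarrow> k \<le> length D \<and> j < strands 2 (take k D)" for k j
    by (simp add: points_def)
  have "level D c k = (s # ss) ! k" if "k \<le> length D" for k
  proof (rule nth_equalityI)
    show "length (level D c k) = length ((s # ss) ! k)"
      using len[OF that] by simp
    show "level D c k ! j = (s # ss) ! k ! j" if "j < length (level D c k)" for j
      using that \<open>k \<le> length D\<close> by (simp add: nth_level c_arc points val_def)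
  qed
  moreover have "c \<in> colorings D"
    unfolding colorings_def
  proof (intro CollectI conjI allI impI)
    show "c a = 0" if "a \<notin> arcs D" for a
      using that by (simp add: c_def)
    show "2 * c (arc D (k, i)) = c (arc D (k, i + 1)) + c (arc D (k + 1, i))"
      if "k < length D \<and> D ! k = (i, OverRight)" for k i
    proof -
      from that have k: "k < length D" "D ! k = (i, OverRight)" by simp_all
      show ?thesis
        using layer[OF k] diagram_nth[OF D k] strands_take_Suc[OF k, of 2] k(1)
        by (simp add: c_arc points val_def layer_iff_nth)
    qed
    show "2 * c (arc D (k, i + 1)) = c (arc D (k, i)) + c (arc D (k + 1, i + 1))"
      if "k < length D \<and> D ! k = (i, OverLeft)" for k i
    proof -
      from that have k: "k < length D" "D ! k = (i, OverLeft)" by simp_all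
      show ?thesis
        using layer[OF k] diagram_nth[OF D k] strands_take_Suc[OF k, of 2] k(1)
        by (simp add: c_arc points val_def layer_iff_nth)
    qed
  qed
  ultimately show thesis using that by blast
qed

lemma colorings_eqI:
  assumes "c \<in> colorings D" "c' \<in> colorings D"
    and "\<And>k. k \<le> length D \<Longrightarrow> level D c k = level D c' k"
  shows "c = c'"
proof
  fix a
  show "c a = c' a"
  proof (cases "a \<in> arcs D")
    case True
    then obtain k j where "a = arc D (k, j)" "k \<le> length D" "j < strands 2 (take k D)"
      by (auto simp: arcs_def points_def)
    then show ?thesis
      using assms(3)[of k] nth_level[of j k D] by metis
  next
    case False
    then show ?thesis using assms(1,2) by (simp add: colorings_def)
  qed
qed

section \<open>Spans and their images in \<open>\<complex>\<^sup>4\<close>\<close>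

definition boundary_values :: "layers \<Rightarrow> ((nat \<times> nat) set \<Rightarrow> complex) \<Rightarrow>
    (complex \<times> complex) \<times> (complex \<times> complex)" where
  "boundary_values D c =
    (source_leg (alexander_span D) c, target_leg (alexander_span D) c)"

lemma level_ends:
  assumes "two_tangle D"
  shows "level D c 0 = [fst (fst (boundary_values D c)), snd (fst (boundary_values D c))]"
    "level D c (length D) = [fst (snd (boundary_values D c)), snd (snd (boundary_values D c))]"
  using diagram_strands[OF assms]
  by (simp_all add: level_def boundary_values_def alexander_span_def numeral_2_eq_2)

lemma boundary_values_image:
  assumes D: "two_tangle D"
  shows "((x0, x1), (y0, y1)) \<in> boundary_values D ` colorings D \<longleftrightarrow>
    connects D [x0, x1] [y0, y1]"
proof
  assume "((x0, x1), (y0, y1)) \<in> boundary_values D ` colorings D"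
  then obtain c where c: "c \<in> colorings D" and "boundary_values D c = ((x0, x1), (y0, y1))"
    by force
  then show "connects D [x0, x1] [y0, y1]"
    using coloring_trace[OF D c] level_ends[OF D, of c] unfolding connects_def by auto
next
  assume "connects D [x0, x1] [y0, y1]"
  then obtain ss where tr: "trace [x0, x1] D ss [y0, y1]"
    unfolding connects_def by blast
  then obtain c where c: "c \<in> colorings D"
    and level: "\<And>k. k \<le> length D \<Longrightarrow> level D c k = ([x0, x1] # ss) ! k"
    using trace_coloring[OF D tr] by auto
  have "level D c 0 = [x0, x1]"
    using level[of 0] by simp
  moreover have "level D c (length D) = [y0, y1]"
    using level[of "length D"] trace_last[OF tr] trace_length[OF tr]
      last_conv_nth[of "[x0, x1] # ss"] by (simp del: last.simps)
  ultimately have "boundary_values D c = ((x0, x1), (y0, y1))"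
    using level_ends[OF D, of c] by (cases "boundary_values D c") auto
  then show "((x0, x1), (y0, y1)) \<in> boundary_values D ` colorings D"
    using c by force
qed

lemma inj_on_boundary_values:
  assumes D: "two_tangle D" and det: "determined 2 D"
  shows "inj_on (boundary_values D) (colorings D)"
proof (rule inj_onI)
  fix c c' assume c: "c \<in> colorings D" "c' \<in> colorings D"
    and eq: "boundary_values D c = boundary_values D c'"
  from eq have ends: "level D c 0 = level D c' 0" "level D c (length D) = level D c' (length D)"
    using level_ends[OF D] by simp_all
  have "length (level D c 0) = 2" by simp
  then have ss: "map (\<lambda>k. level D c (Suc k)) [0..<length D] =
      map (\<lambda>k. level D c' (Suc k)) [0..<length D]"
    using coloring_trace[OF D c(1)] coloring_trace[OF D c(2)] det ends
    unfolding determined_def by metis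
  have "level D c k = level D c' k" if "k \<le> length D" for k
    using that ends ss by (cases k) auto
  then show "c = c'" by (rule colorings_eqI[OF c])
qed

lemma colorings_add: "c \<in> colorings D \<Longrightarrow> c' \<in> colorings D \<Longrightarrow> (\<lambda>a. c a + c' a) \<in> colorings D"
  by (simp add: colorings_def distrib_left)

lemma colorings_scale: "c \<in> colorings D \<Longrightarrow> (\<lambda>a. z * c a) \<in> colorings D"
  by (simp add: colorings_def mult.left_commute flip: distrib_left)

text \<open>Each apex embeds into \<open>\<complex>\<^sup>4\<close>, so the isomorphism has to match
  colourings with equal boundary values. Its linearity follows by uniqueness, because the two sides
  of each linearity equation have the same boundary values.\<close>

lemma span_equivalentI:
  assumes inj: "inj_on (boundary_values D) (colorings D)" "inj_on (boundary_values E) (colorings E)"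
    and img: "boundary_values D ` colorings D = boundary_values E ` colorings E"
  shows "span_equivalent (alexander_span D) (alexander_span E)"
proof -
  define \<phi> where "\<phi> = (\<lambda>c. inv_into (colorings E) (boundary_values E) (boundary_values D c))"
  have \<phi>: "\<phi> c \<in> colorings E" "boundary_values E (\<phi> c) = boundary_values D c"
    if "c \<in> colorings D" for c
    using that img inv_into_into[of "boundary_values D c" "boundary_values E" "colorings E"]
      f_inv_into_f[of "boundary_values D c" "boundary_values E" "colorings E"]
    by (auto simp: \<phi>_def)
  have unique: "\<phi> c = e" if "c \<in> colorings D" "e \<in> colorings E"
    "boundary_values E e = boundary_values D c" for c e
    using that \<phi> inj(2) by (metis inj_onD)
  have "inj_on \<phi> (colorings D)"
    using inj(1) \<phi>(2) by (metis inj_on_def)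
  moreover have "\<phi> ` colorings D = colorings E"
  proof
    show "colorings E \<subseteq> \<phi> ` colorings D"
    proof
      fix e assume e: "e \<in> colorings E"
      then obtain c where "c \<in> colorings D" "boundary_values E e = boundary_values D c"
        using img by (metis imageE imageI)
      then show "e \<in> \<phi> ` colorings D" using unique e by blast
    qed
  qed (use \<phi> in blast)
  moreover have "\<phi> (\<lambda>a. u a + v a) = (\<lambda>a. \<phi> u a + \<phi> v a)"
    if "u \<in> colorings D" "v \<in> colorings D" for u v
    using \<phi>[OF that(1)] \<phi>[OF that(2)] that
    by (intro unique colorings_add) (auto simp: boundary_values_def alexander_span_def)
  moreover have "\<phi> (\<lambda>a. z * u a) = (\<lambda>a. z * \<phi> u a)" if "u \<in> colorings D" for z u
    using \<phi>[OF that] that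
    by (intro unique colorings_scale) (auto simp: boundary_values_def alexander_span_def)
  ultimately have "linear_iso \<phi> (colorings D) (colorings E)"
    by (simp add: linear_iso_def bij_betw_def)
  moreover have "source_leg (alexander_span D) c = source_leg (alexander_span E) (\<phi> c) \<and>
      target_leg (alexander_span D) c = target_leg (alexander_span E) (\<phi> c)"
    if "c \<in> colorings D" for c
    using \<phi>(2)[OF that] by (simp add: boundary_values_def)
  ultimately show ?thesis
    unfolding span_equivalent_def by (auto simp: alexander_span_def)
qed

text \<open>An equivalence commutes with both legs and is onto, so it preserves their joint image;
  this direction works without joint injectivity.\<close>

lemma span_equivalent_image:
  assumes "span_equivalent (alexander_span D) (alexander_span E)"
  shows "boundary_values D ` colorings D = boundary_values E ` colorings E"
proof -
  have apex: "apex (alexander_span X) = colorings X" for X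
    by (simp add: alexander_span_def)
  obtain \<phi> where "bij_betw \<phi> (colorings D) (colorings E)"
    and "\<And>c. c \<in> colorings D \<Longrightarrow> boundary_values D c = boundary_values E (\<phi> c)"
    using assms unfolding span_equivalent_def apex linear_iso_def boundary_values_def by auto
  then show ?thesis
    unfolding bij_betw_def by (metis (no_types, lifting) image_cong image_image)
qed

lemma boundary_abs_tangle:
  assumes "two_tangle D"
  shows "boundary (abs_tangle D) = {([x0, x1], [y0, y1]) | x0 x1 y0 y1.
    ((x0, x1), (y0, y1)) \<in> boundary_values D ` colorings D}"
proof -
  have mem: "(s, t) \<in> boundary (abs_tangle D) \<longleftrightarrow> length s = 2 \<and> connects D s t" for s t
    using assms by (simp add: boundary.abs_eq iso_refl)
  show ?thesis
    unfolding boundary_values_image[OF assms]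
  proof (intro set_eqI iffI)
    fix z assume z: "z \<in> boundary (abs_tangle D)"
    then obtain x0 x1 y0 y1 where "z = ([x0, x1], [y0, y1])"
      by (cases z) (auto elim: boundary_length)
    with z show "z \<in> {([x0, x1], [y0, y1]) | x0 x1 y0 y1. connects D [x0, x1] [y0, y1]}"
      by (simp add: mem)
  qed (auto simp: mem)
qed

theorem corollary6p7:
  fixes T T' :: layers
  assumes "rational T" and "rational T'"
  shows "isotopic T T' \<longleftrightarrow> span_equivalent (alexander_span T) (alexander_span T')"
proof
  have two: "two_tangle T" "two_tangle T'" and orbit: "orbit (abs_tangle T)" "orbit (abs_tangle T')"
    using assms rational_orbit by blast+
  have det: "determined 2 T" "determined 2 T'"
    using orbit[THEN rigid_orbit] two by (simp_all add: rigid.abs_eq iso_refl)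
  {
    assume "isotopic T T'"
    then have iso: "iso 2 2 T T'" using two(1) by (simp add: isotopic_iff_iso)
    have "boundary_values T ` colorings T = boundary_values T' ` colorings T'"
    proof (rule set_eqI)
      fix z :: "(complex \<times> complex) \<times> (complex \<times> complex)"
      obtain x0 x1 y0 y1 where z: "z = ((x0, x1), (y0, y1))"
        by (metis prod.exhaust)
      show "z \<in> boundary_values T ` colorings T \<longleftrightarrow> z \<in> boundary_values T' ` colorings T'"
        unfolding z boundary_values_image[OF two(1)] boundary_values_image[OF two(2)]
        by (rule iso_invariant(1)[OF iso]) simp
    qed
    with two det show "span_equivalent (alexander_span T) (alexander_span T')"
      by (intro span_equivalentI inj_on_boundary_values)
  next
    assume "span_equivalent (alexander_span T) (alexander_span T')"
    then have "boundary (abs_tangle T) = boundary (abs_tangle T')"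
      using two by (simp add: boundary_abs_tangle span_equivalent_image)
    then show "isotopic T T'"
      by (rule rational_boundary_eq_imp_isotopic[OF assms])
  }
qed

end
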